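(* Let $V>0$ and let $(\alpha(t),\beta(t),\nu(t))$ be the solution of the dynamical system $$\dot\alpha=-\mathbb E\left[\tfrac{\partial K}{\partial\alpha}\right],\quad \dot\beta=-\mathbb E\left[\tfrac{\partial K}{\partial\beta}\right],\quad \dot\nu=-\mathbb E\left[\tfrac{\partial K}{\partial\nu}\right]$$ (right-hand sides given in the context), with arbitrary initial values $\alpha(0),\beta(0),\nu(0)>0$. Put $$V_{\rm est}=V_{\rm est}(t):=\frac{\beta(t)(\nu(t)+1)}{(\alpha(t)-1)\nu(t)}.$$ Then for any $\varkappa>0$, writing $\alpha=\alpha(t)$, $$\left(1-\frac\varkappa\alpha\right)\frac{\alpha-A(\alpha)}{\alpha-1}<\frac{V_{\rm est}}{V}<\frac{\alpha-A(\alpha)}{\alpha-1}\qquad\text{for all large enough } t.$$ In particular, $V_{\rm est}\to V$ as $t\to\infty$.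
   Context: The right-hand sides are, for $\alpha,\beta,\nu>0$, with $\sigma=\beta(\nu+1)/\nu$ and $\Psi=\Gamma'/\Gamma$ the digamma function, $$\mathbb E\left[\tfrac{\partial K}{\partial\alpha}\right]=\frac1{(2\pi)^{1/2}}\int_{-\infty}^\infty\ln\left(1+\frac V\sigma\frac{z^2}2\right)e^{-z^2/2}dz+\Psi(\alpha)-\Psi\left(\alpha+\tfrac12\right),$$ $$\mathbb E\left[\tfrac{\partial K}{\partial\beta}\right]=\frac1\beta\left(\frac{\alpha+1/2}{(2\pi)^{1/2}}\int_{-\infty}^\infty\frac{1}{1+\frac V\sigma\frac{z^2}2}e^{-z^2/2}dz-\alpha\right),$$ $$\mathbb E\left[\tfrac{\partial K}{\partial\nu}\right]=\frac1{2\nu(\nu+1)}\left(\frac{2\alpha+1}{(2\pi)^{1/2}}\int_{-\infty}^\infty\frac{z^2}{\frac{2\sigma}{V}+z^2}e^{-z^2/2}dz-1\right).$$ For $x>0$ let $F(x)=\frac1{(2\pi)^{1/2}}\int_{-\infty}^\infty\frac1{2x+z^2}e^{-z^2/2}dz$. For $\alpha>0$, $A=A(\alpha)<\alpha$ is the unique root of $F(\alpha-A)=\frac{\alpha}{(2\alpha+1)(\alpha-A)}$. ($V$ is the variance of the ground truth normal distribution and $V_{\rm est}$ is the variance of the predictive Student's t-distribution.) *)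

theory Defs
  imports "HOL-Analysis.Analysis"
begin

definition \<sigma> :: "real \<Rightarrow> real \<Rightarrow> real" where
  "\<sigma> \<beta> \<nu> = \<beta> * (\<nu> + 1) / \<nu>"

text \<open>The expected partial derivatives of \<open>K\<close>. They are meaningful for
  \<open>\<alpha>, \<beta>, \<nu>, V > 0\<close>, where all the integrands are Lebesgue integrable.\<close>

definition E_dK_d\<alpha> :: "real \<Rightarrow> real \<Rightarrow> real \<Rightarrow> real \<Rightarrow> real" where
  "E_dK_d\<alpha> V \<alpha> \<beta> \<nu> =
     1 / sqrt (2 * pi) *
       (\<integral>z. ln (1 + V / \<sigma> \<beta> \<nu> * (z\<^sup>2 / 2)) * exp (- z\<^sup>2 / 2) \<partial>lborel)
     + Digamma \<alpha> - Digamma (\<alpha> + 1 / 2)"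

definition E_dK_d\<beta> :: "real \<Rightarrow> real \<Rightarrow> real \<Rightarrow> real \<Rightarrow> real" where
  "E_dK_d\<beta> V \<alpha> \<beta> \<nu> =
     1 / \<beta> *
       ((\<alpha> + 1 / 2) / sqrt (2 * pi) *
          (\<integral>z. 1 / (1 + V / \<sigma> \<beta> \<nu> * (z\<^sup>2 / 2)) * exp (- z\<^sup>2 / 2) \<partial>lborel)
        - \<alpha>)"

definition E_dK_d\<nu> :: "real \<Rightarrow> real \<Rightarrow> real \<Rightarrow> real \<Rightarrow> real" where
  "E_dK_d\<nu> V \<alpha> \<beta> \<nu> =
     1 / (2 * \<nu> * (\<nu> + 1)) *
       ((2 * \<alpha> + 1) / sqrt (2 * pi) *
          (\<integral>z. z\<^sup>2 / (2 * \<sigma> \<beta> \<nu> / V + z\<^sup>2) * exp (- z\<^sup>2 / 2) \<partial>lborel)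
        - 1)"

definition F :: "real \<Rightarrow> real" where
  "F x = 1 / sqrt (2 * pi) * (\<integral>z. 1 / (2 * x + z\<^sup>2) * exp (- z\<^sup>2 / 2) \<partial>lborel)"

definition A :: "real \<Rightarrow> real" where
  "A \<alpha> = (THE a. a < \<alpha> \<and> F (\<alpha> - a) = \<alpha> / ((2 * \<alpha> + 1) * (\<alpha> - a)))"

definition V_est :: "real \<Rightarrow> real \<Rightarrow> real \<Rightarrow> real" where
  "V_est \<alpha> \<beta> \<nu> = \<beta> * (\<nu> + 1) / ((\<alpha> - 1) * \<nu>)"

end

theory Submission
  imports Defs "HOL-Probability.Distributions" "HOL-Real_Asymp.Real_Asymp"
begin

text \<open>
  Let \<open>Z\<close> be standard normal and put \<open>s = \<sigma> / V\<close>. The three right-hand sides involve only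
  \<open>G(s) = E ln (1 + Z\<^sup>2 / (2 s))\<close> (\<open>log_mean\<close>) and \<open>R(s) = E (Z\<^sup>2 / (2 s + Z\<^sup>2))\<close> (\<open>deficit\<close>). With
  \<open>b(s) = (1 / R(s) - 1) / 2\<close> (\<open>balance\<close>) and \<open>\<phi>(x) = \<Psi>(x + 1/2) - \<Psi>(x)\<close> (\<open>digamma_gap\<close>) the
  system becomes

    \<open>\<alpha>' = \<phi>(\<alpha>) - G(s)\<close>, \<open>s' = c R(s) (\<alpha> - b(s))\<close>, \<open>c = ((\<nu> + 1) / (\<beta> \<nu>) + \<beta> / (\<nu>\<^sup>3 (\<nu> + 1))) / V > 0\<close>,

  where \<open>c\<close> is bounded away from 0 because \<open>\<beta>\<^sup>2/2 + \<nu>\<^sup>2/2 + \<nu>\<^sup>3/3\<close> is conserved. The defining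
  equation of \<open>A\<close> says \<open>b(\<alpha> - A(\<alpha>)) = \<alpha>\<close>, and \<open>V_est / V = s / (\<alpha> - 1)\<close>. So the claim is that \<open>s\<close>
  approaches, from below, the point \<open>\<alpha> - A(\<alpha>)\<close> at which \<open>b\<close> takes the value \<open>\<alpha>\<close>. Since \<open>b' \<ge> 1\<close>
  (\<open>balance_derivative\<close>, from the Cauchy--Schwarz inequality), the distance from \<open>s\<close> to that point is
  at most the gap \<open>B = \<alpha> - b(s)\<close>. As \<open>b(s) / s\<close> tends to 1, everything follows once \<open>B\<close> is
  eventually positive, \<open>B\<close> tends to 0 and \<open>s\<close> tends to infinity.

  The decisive fact is \<open>\<phi>(b(s)) > G(s)\<close> for all \<open>s > 0\<close> (\<open>log_mean_less_digamma_gap\<close>): the flow has no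
  equilibrium. For \<open>x = b(s)\<close> the variable \<open>w = 1 / (1 + z\<^sup>2 / (2 s))\<close> has the same mean under the
  normal law and under the Student law with density proportional to \<open>w powr (x + 1/2)\<close>. As functions
  of \<open>w\<close>, the normal density exceeds the Student density exactly between two points, so the Student
  law of \<open>w\<close> is more spread out and gives the convex function \<open>- ln w\<close> the larger mean. Its Student
  mean is \<open>\<phi>(x)\<close>, its normal mean is \<open>G(s)\<close>.

  Now the dynamics. Whenever \<open>B = 0\<close>, \<open>B' = \<alpha>' = \<phi>(b(s)) - G(s) > 0\<close>, so positivity of \<open>B\<close> persists.
  As long as \<open>B \<le> 0\<close>, \<open>\<alpha>\<close> and \<open>\<nu>\<close> increase and \<open>s\<close> decreases; once \<open>B > 0\<close>, \<open>s\<close> and \<open>\<beta>\<close> increase.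
  These monotonicities keep the trajectory inside the positive octant (\<open>always_positive\<close>). If \<open>s\<close>
  converged to some \<open>l > 0\<close>, then \<open>\<alpha>\<close> would be driven above a level beyond \<open>b(l)\<close>, so \<open>B\<close> would be
  bounded below by a positive constant (\<open>gap_eventually_bounded_below\<close>). This excludes \<open>B \<le> 0\<close>
  forever, and it makes \<open>s\<close> grow linearly in the other case, so \<open>s\<close> tends to infinity. Finally, while
  \<open>B \<ge> e > 0\<close>, the speed of \<open>b(s)\<close> is at least of order \<open>e / s\<close>, whereas \<open>\<alpha>' \<le> \<phi>(s) - G(s) = O(1 / s\<^sup>2)\<close>;
  hence \<open>B\<close> decreases at least half as fast as \<open>b(s)\<close> increases and must fall below \<open>e\<close>.
\<close>

section \<open>Expectations under the standard normal law\<close>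

definition std_normal :: "real measure" where
  "std_normal = density lborel (\<lambda>z. ennreal (std_normal_density z))"

definition deficit :: "real \<Rightarrow> real" where
  "deficit s = (\<integral>z. z\<^sup>2 / (2 * s + z\<^sup>2) \<partial>std_normal)"

definition log_mean :: "real \<Rightarrow> real" where
  "log_mean s = (\<integral>z. ln (1 + z\<^sup>2 / (2 * s)) \<partial>std_normal)"

text \<open>The value of \<open>\<alpha>\<close> at which the expected derivatives in \<open>\<beta>\<close> and \<open>\<nu>\<close> vanish for the given \<open>s = \<sigma> / V\<close>.\<close>

definition balance :: "real \<Rightarrow> real" where
  "balance s = (1 / deficit s - 1) / 2"

lemma space_std_normal [simp]: "space std_normal = UNIV"
  by (simp add: std_normal_def)

lemma sets_std_normal [simp, measurable_cong]: "sets std_normal = sets borel"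
  by (simp add: std_normal_def)

interpretation std_normal: prob_space std_normal
  unfolding std_normal_def by (rule prob_space_normal_density) simp

lemma std_normal_integral:
  fixes f :: "real \<Rightarrow> real"
  assumes "f \<in> borel_measurable borel"
  shows "integral\<^sup>L std_normal f = (\<integral>z. std_normal_density z * f z \<partial>lborel)"
  unfolding std_normal_def using assms
  by (subst integral_density) auto

lemma std_normal_integrable_iff:
  fixes f :: "real \<Rightarrow> real"
  assumes "f \<in> borel_measurable borel"
  shows "integrable std_normal f \<longleftrightarrow> integrable lborel (\<lambda>z. std_normal_density z * f z)"
  unfolding std_normal_def using assms
  by (subst integrable_density) auto

lemma std_normal_integral_exp:
  fixes f :: "real \<Rightarrow> real"
  assumes "f \<in> borel_measurable borel"
  shows "1 / sqrt (2 * pi) * (\<integral>z. f z * exp (- z\<^sup>2 / 2) \<partial>lborel) = integral\<^sup>L std_normal f"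
proof -
  have "(\<integral>z. std_normal_density z * f z \<partial>lborel)
      = (\<integral>z. 1 / sqrt (2 * pi) * (f z * exp (- z\<^sup>2 / 2)) \<partial>lborel)"
    by (rule Bochner_Integration.integral_cong) (simp_all add: std_normal_density_def)
  then show ?thesis using std_normal_integral[OF assms] by simp
qed

lemma integrable_std_normal_power: "integrable std_normal (\<lambda>z. z ^ k)"
  using integrable_std_normal_moment[of k] by (subst std_normal_integrable_iff) auto

lemma std_normal_moment2: "(\<integral>z. z\<^sup>2 \<partial>std_normal) = 1"
  using integral_std_normal_moment_even[of 1] by (subst std_normal_integral) (auto simp: fact_numeral)

lemma std_normal_moment4: "(\<integral>z. z ^ 4 \<partial>std_normal) = 3"
  using integral_std_normal_moment_even[of 2] by (subst std_normal_integral) (auto simp: fact_numeral)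

lemma integrable_deficit: "s > 0 \<Longrightarrow> integrable std_normal (\<lambda>z. z\<^sup>2 / (2 * s + z\<^sup>2))"
  by (rule std_normal.integrable_const_bound[where B = 1])
     (auto simp: divide_simps add_pos_nonneg)

lemma integrable_log_mean:
  assumes "s > 0"
  shows "integrable std_normal (\<lambda>z. ln (1 + z\<^sup>2 / (2 * s)))"
proof (rule Bochner_Integration.integrable_bound)
  show "integrable std_normal (\<lambda>z. z\<^sup>2 / (2 * s))"
    using integrable_std_normal_power[of 2] by simp
  show "AE z in std_normal. norm (ln (1 + z\<^sup>2 / (2 * s))) \<le> norm (z\<^sup>2 / (2 * s))"
  proof (rule AE_I2)
    fix z :: real
    have "0 \<le> z\<^sup>2 / (2 * s)" using assms by simp
    then show "norm (ln (1 + z\<^sup>2 / (2 * s))) \<le> norm (z\<^sup>2 / (2 * s))"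
      using ln_add_one_self_le_self[of "z\<^sup>2 / (2 * s)"] assms by (simp add: ln_ge_zero)
  qed
qed (use assms in simp)

lemma std_normal_not_AE_finite:
  assumes "finite N" shows "\<not> (AE z in std_normal. z \<in> N)"
proof
  assume "AE z in std_normal. z \<in> N"
  moreover have "AE z in std_normal. z \<notin> N"
  proof -
    have "AE z in lborel. z \<notin> N"
      by (rule AE_not_in) (simp add: assms finite_imp_null_set_lborel)
    then show ?thesis unfolding std_normal_def by (subst AE_density) auto
  qed
  ultimately have "AE z in std_normal. False" by eventually_elim auto
  then show False using std_normal.prob_space_axioms by (simp add: std_normal.AE_False)
qed

lemma deficit_pos: assumes "s > 0" shows "deficit s > 0"
proof -
  have "deficit s \<noteq> 0"
  proof
    assume "deficit s = 0"
    then have "AE z in std_normal. z\<^sup>2 / (2 * s + z\<^sup>2) = 0"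
      unfolding deficit_def using assms
      by (subst (asm) integral_nonneg_eq_0_iff_AE) (auto intro: integrable_deficit)
    then have "AE z in std_normal. z \<in> {0}"
    proof eventually_elim
      case (elim z)
      have "2 * s + z\<^sup>2 > 0" using assms by (simp add: add_pos_nonneg)
      with elim show ?case by simp
    qed
    then show False using std_normal_not_AE_finite[of "{0}"] by simp
  qed
  moreover have "deficit s \<ge> 0" unfolding deficit_def
    using assms by (intro integral_nonneg_AE) auto
  ultimately show ?thesis by simp
qed

lemma weight_mean:
  assumes "s > 0"
  shows "integrable std_normal (\<lambda>z. 1 / (1 + z\<^sup>2 / (2 * s)))"
    and "(\<integral>z. 1 / (1 + z\<^sup>2 / (2 * s)) \<partial>std_normal) = 1 - deficit s"
proof -
  have *: "(\<lambda>z. 1 / (1 + z\<^sup>2 / (2 * s))) = (\<lambda>z. 1 - z\<^sup>2 / (2 * s + z\<^sup>2))"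
  proof
    fix z :: real
    have "2 * s + z\<^sup>2 > 0" using assms by (simp add: add_pos_nonneg)
    then show "1 / (1 + z\<^sup>2 / (2 * s)) = 1 - z\<^sup>2 / (2 * s + z\<^sup>2)"
      using assms by (simp add: divide_simps)
  qed
  show "integrable std_normal (\<lambda>z. 1 / (1 + z\<^sup>2 / (2 * s)))"
    unfolding * using integrable_deficit[OF assms] by simp
  show "(\<integral>z. 1 / (1 + z\<^sup>2 / (2 * s)) \<partial>std_normal) = 1 - deficit s"
    unfolding * deficit_def using integrable_deficit[OF assms] std_normal.prob_space by simp
qed

lemma deficit_less_1: assumes "s > 0" shows "deficit s < 1"
proof -
  have *: "1 / (1 + z\<^sup>2 / (2 * s)) > 0" for z :: real
    using assms by (simp add: add_pos_nonneg)
  have "1 - deficit s \<noteq> 0"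
  proof
    assume "1 - deficit s = 0"
    then have "AE z in std_normal. 1 / (1 + z\<^sup>2 / (2 * s)) = 0"
      using assms weight_mean[OF assms] *
      by (subst integral_nonneg_eq_0_iff_AE[symmetric]) (auto simp: less_imp_le)
    then have "AE z in std_normal. z \<in> {}"
      by eventually_elim (use * in \<open>metis less_irrefl\<close>)
    then show False using std_normal_not_AE_finite[of "{}"] by simp
  qed
  moreover have "1 - deficit s \<ge> 0"
    unfolding weight_mean(2)[OF assms, symmetric] using *
    by (intro integral_nonneg_AE) (auto simp: less_imp_le)
  ultimately show ?thesis by simp
qed

lemma balance_pos: "s > 0 \<Longrightarrow> balance s > 0"
  using deficit_pos[of s] deficit_less_1[of s] by (simp add: balance_def)

lemma deficit_balance: "s > 0 \<Longrightarrow> deficit s * (2 * balance s + 1) = 1"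
  using deficit_pos[of s] by (simp add: balance_def field_simps)

lemma integrable_deficit_sq:
  assumes "s > 0" shows "integrable std_normal (\<lambda>z. z\<^sup>2 / (2 * s + z\<^sup>2)\<^sup>2)"
proof (rule std_normal.integrable_const_bound[where B = "1 / (2 * s)"])
  show "AE z in std_normal. norm (z\<^sup>2 / (2 * s + z\<^sup>2)\<^sup>2) \<le> 1 / (2 * s)"
  proof (rule AE_I2)
    fix z :: real
    have "z\<^sup>2 / (2 * s + z\<^sup>2)\<^sup>2 = z\<^sup>2 / (2 * s + z\<^sup>2) * (1 / (2 * s + z\<^sup>2))"
      by (simp add: power2_eq_square)
    also have "\<dots> \<le> 1 * (1 / (2 * s))"
      using assms by (intro mult_mono) (auto simp: divide_simps add_pos_nonneg)
    finally show "norm (z\<^sup>2 / (2 * s + z\<^sup>2)\<^sup>2) \<le> 1 / (2 * s)" by simp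
  qed
qed (use assms in simp)

text \<open>Second-order remainder of \<open>deficit\<close>. It yields the derivative without an interchange theorem for
  limits and integrals, because the remainder of the integrand is bounded uniformly in \<open>z\<close>.\<close>

lemma deficit_taylor:
  assumes "s > 0" "y > 0"
  shows "\<bar>deficit y - deficit s + 2 * (y - s) * (\<integral>z. z\<^sup>2 / (2 * s + z\<^sup>2)\<^sup>2 \<partial>std_normal)\<bar>
           \<le> (y - s)\<^sup>2 / (y * s)"
proof -
  let ?f = "\<lambda>z. z\<^sup>2 / (2 * y + z\<^sup>2) - z\<^sup>2 / (2 * s + z\<^sup>2) + 2 * (y - s) * (z\<^sup>2 / (2 * s + z\<^sup>2)\<^sup>2)"
  have int: "integrable std_normal ?f"
    using integrable_deficit[OF assms(1)] integrable_deficit[OF assms(2)] integrable_deficit_sq[OF assms(1)]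
    by (simp del: times_divide_eq_right)
  have f: "0 \<le> ?f z \<and> ?f z \<le> (y - s)\<^sup>2 / (y * s)" for z
  proof -
    define p q where "p = 2 * y + z\<^sup>2" and "q = 2 * s + z\<^sup>2"
    have p: "p \<ge> 2 * y" "p > 0" and q: "q \<ge> 2 * s" "q > 0" "q \<ge> z\<^sup>2"
      using assms by (auto simp: p_def q_def add_pos_nonneg)
    have pq: "2 * (y - s) = p - q" by (simp add: p_def q_def)
    have "?f z = z\<^sup>2 / p - z\<^sup>2 / q + (p - q) * (z\<^sup>2 / q\<^sup>2)" by (simp add: p_def q_def)
    also have "\<dots> = (p - q)\<^sup>2 / p * (z\<^sup>2 / q\<^sup>2)"
      using p q by (simp add: field_simps power2_eq_square)
    finally have f: "?f z = (p - q)\<^sup>2 / p * (z\<^sup>2 / q\<^sup>2)" .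
    have "z\<^sup>2 / q\<^sup>2 = z\<^sup>2 / q * (1 / q)" by (simp add: power2_eq_square)
    also have "\<dots> \<le> 1 * (1 / (2 * s))"
      using q assms by (intro mult_mono) (auto simp: divide_simps)
    finally have "(p - q)\<^sup>2 / p * (z\<^sup>2 / q\<^sup>2) \<le> (p - q)\<^sup>2 / (2 * y) * (1 / (2 * s))"
      using p assms by (intro mult_mono) (auto intro!: divide_left_mono)
    also have "\<dots> = (y - s)\<^sup>2 / (y * s)"
      by (simp add: pq[symmetric] power_mult_distrib del: right_diff_distrib_numeral)
    finally show ?thesis unfolding f using p q by simp
  qed
  have "(\<integral>z. ?f z \<partial>std_normal) = deficit y - deficit s + 2 * (y - s) * (\<integral>z. z\<^sup>2 / (2 * s + z\<^sup>2)\<^sup>2 \<partial>std_normal)"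
    using integrable_deficit[OF assms(1)] integrable_deficit[OF assms(2)] integrable_deficit_sq[OF assms(1)]
    by (simp add: deficit_def del: times_divide_eq_right)
  moreover have "0 \<le> (\<integral>z. ?f z \<partial>std_normal)"
    using f by (intro integral_nonneg_AE) auto
  moreover have "(\<integral>z. ?f z \<partial>std_normal) \<le> (\<integral>z. (y - s)\<^sup>2 / (y * s) \<partial>std_normal)"
    using f int by (intro integral_mono) auto
  ultimately show ?thesis using std_normal.prob_space by simp
qed

lemma deficit_derivative:
  assumes "s > 0"
  shows "(deficit has_real_derivative - 2 * (\<integral>z. z\<^sup>2 / (2 * s + z\<^sup>2)\<^sup>2 \<partial>std_normal)) (at s)"
proof -
  define M where "M = (\<integral>z. z\<^sup>2 / (2 * s + z\<^sup>2)\<^sup>2 \<partial>std_normal)"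
  have "((\<lambda>y. (deficit y - deficit s) / (y - s) - (- 2 * M)) \<longlongrightarrow> 0) (at s)"
  proof (rule Lim_null_comparison)
    have "eventually (\<lambda>y. y > 0) (at s)"
      using assms by (auto intro!: order_tendstoD tendsto_ident_at)
    moreover have "eventually (\<lambda>y. y \<noteq> s) (at s)"
      by (simp add: eventually_at_filter)
    ultimately show "\<forall>\<^sub>F y in at s. norm ((deficit y - deficit s) / (y - s) - (- 2 * M)) \<le> \<bar>y - s\<bar> / (y * s)"
    proof eventually_elim
      case (elim y)
      have "(deficit y - deficit s) / (y - s) - (- 2 * M) = (deficit y - deficit s + 2 * (y - s) * M) / (y - s)"
        using elim by (simp add: field_simps)
      then have "norm ((deficit y - deficit s) / (y - s) - (- 2 * M))
          = \<bar>deficit y - deficit s + 2 * (y - s) * M\<bar> / \<bar>y - s\<bar>"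
        by (simp only: real_norm_def abs_divide)
      also have "\<dots> \<le> ((y - s)\<^sup>2 / (y * s)) / \<bar>y - s\<bar>"
        using deficit_taylor[OF assms elim(1)] unfolding M_def by (rule divide_right_mono) simp
      also have "(y - s)\<^sup>2 = \<bar>y - s\<bar> * \<bar>y - s\<bar>" by (simp add: power2_eq_square)
      also have "k * k / (y * s) / k = k / (y * s)" for k by (cases "k = 0") auto
      finally show ?case .
    qed
    show "((\<lambda>y. \<bar>y - s\<bar> / (y * s)) \<longlongrightarrow> 0) (at s)"
      using assms by (auto intro!: tendsto_eq_intros)
  qed
  then show ?thesis
    unfolding has_field_derivative_iff M_def[symmetric] by (rule LIM_zero_cancel)
qed

text \<open>The Cauchy--Schwarz inequality for \<open>Z\<close> and \<open>Z / (2 s + Z\<^sup>2)\<close>, using that \<open>Z\<close> has second moment 1.\<close>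

lemma deficit_sq_le:
  assumes "s > 0"
  shows "(deficit s)\<^sup>2 \<le> (\<integral>z. z\<^sup>2 / (2 * s + z\<^sup>2)\<^sup>2 \<partial>std_normal)"
proof -
  define r where "r = deficit s"
  have "0 \<le> (\<integral>z. z\<^sup>2 / (2 * s + z\<^sup>2)\<^sup>2 - 2 * r * (z\<^sup>2 / (2 * s + z\<^sup>2)) + r\<^sup>2 * z\<^sup>2 \<partial>std_normal)"
  proof (rule integral_nonneg_AE, rule AE_I2)
    fix z :: real
    have "z\<^sup>2 / (2 * s + z\<^sup>2)\<^sup>2 - 2 * r * (z\<^sup>2 / (2 * s + z\<^sup>2)) + r\<^sup>2 * z\<^sup>2
        = z\<^sup>2 * (1 / (2 * s + z\<^sup>2) - r)\<^sup>2"
      by (simp add: power2_diff power_divide algebra_simps)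
    then show "0 \<le> z\<^sup>2 / (2 * s + z\<^sup>2)\<^sup>2 - 2 * r * (z\<^sup>2 / (2 * s + z\<^sup>2)) + r\<^sup>2 * z\<^sup>2"
      by simp
  qed
  also have "\<dots> = (\<integral>z. z\<^sup>2 / (2 * s + z\<^sup>2)\<^sup>2 \<partial>std_normal) - 2 * r * r + r\<^sup>2"
    using integrable_deficit_sq[OF assms] integrable_deficit[OF assms] integrable_std_normal_power[of 2]
    by (simp add: std_normal_moment2 r_def[unfolded deficit_def, symmetric] del: times_divide_eq_right)
  finally show ?thesis by (simp add: r_def power2_eq_square)
qed

text \<open>The derivative is \<open>E (Z\<^sup>2 / (2 s + Z\<^sup>2)\<^sup>2) / (deficit s)\<^sup>2\<close>. The bound 1 is what turns estimates for
  \<open>\<alpha> - balance s\<close> into estimates for \<open>s\<close>.\<close>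

lemma balance_derivative:
  assumes "s > 0"
  obtains D where "(balance has_real_derivative D) (at s)" "D \<ge> 1"
proof -
  define M where "M = (\<integral>z. z\<^sup>2 / (2 * s + z\<^sup>2)\<^sup>2 \<partial>std_normal)"
  have "(balance has_real_derivative M / (deficit s)\<^sup>2) (at s)"
    unfolding balance_def[abs_def] M_def using deficit_pos[OF assms]
    by (auto intro!: derivative_eq_intros deficit_derivative assms simp: power2_eq_square)
  moreover have "M / (deficit s)\<^sup>2 \<ge> 1"
    using deficit_sq_le[OF assms] deficit_pos[OF assms] by (simp add: M_def)
  ultimately show thesis by (rule that)
qed

lemma balance_diff_ge:
  assumes "0 < x" "x \<le> y"
  shows "balance y - balance x \<ge> y - x"
proof -
  have "balance x - x \<le> balance y - y"
  proof (rule DERIV_nonneg_imp_nondecreasing[OF assms(2)])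
    fix u assume "x \<le> u" "u \<le> y"
    then have "u > 0" using assms by simp
    then obtain D where "(balance has_real_derivative D) (at u)" "D \<ge> 1"
      using balance_derivative by blast
    then show "\<exists>D. ((\<lambda>u. balance u - u) has_real_derivative D) (at u) \<and> 0 \<le> D"
      by (intro exI[of _ "D - 1"]) (auto intro!: derivative_eq_intros)
  qed
  then show ?thesis by simp
qed

lemma balance_strict_mono: "0 < x \<Longrightarrow> x < y \<Longrightarrow> balance x < balance y"
  using balance_diff_ge[of x y] by simp

lemma balance_continuous: "s > 0 \<Longrightarrow> isCont balance s"
  by (metis balance_derivative DERIV_isCont)

text \<open>Let \<open>x\<close> tend to 0 in \<open>balance s \<ge> balance x + s - x\<close> and use that \<open>balance\<close> is positive.\<close>

lemma balance_ge: assumes "s > 0" shows "balance s \<ge> s"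
proof (rule field_le_epsilon)
  fix e :: real assume "e > 0"
  define x where "x = min e s"
  have "x > 0" "x \<le> s" "x \<le> e" using assms \<open>e > 0\<close> by (auto simp: x_def)
  then show "s \<le> balance s + e"
    using balance_diff_ge[of x s] balance_pos[of x] by simp
qed

lemma balance_less_solution:
  assumes "0 < s" "balance s < x"
  obtains y where "y > s" "balance y = x"
proof -
  have "\<exists>y. s \<le> y \<and> y \<le> s + x \<and> balance y = x"
  proof (rule IVT)
    have "x > 0" using assms balance_pos[of s] by simp
    then show "s \<le> s + x" "x \<le> balance (s + x)"
      using balance_ge[of "s + x"] assms by auto
  qed (use assms in \<open>auto intro: balance_continuous\<close>)
  then show thesis using that assms by (metis less_irrefl order_le_less)
qed

lemma deficit_lower:
  assumes "s > 0" shows "deficit s \<ge> 1 / (2 * s) - 3 / (4 * s\<^sup>2)"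
proof -
  have "1 / (2 * s) - 3 / (4 * s\<^sup>2) = (\<integral>z. z\<^sup>2 / (2 * s) - z ^ 4 / (4 * s\<^sup>2) \<partial>std_normal)"
    using integrable_std_normal_power[of 2] integrable_std_normal_power[of 4]
    by (simp add: std_normal_moment2 std_normal_moment4)
  also have "\<dots> \<le> deficit s"
    unfolding deficit_def
  proof (rule integral_mono)
    fix z :: real
    have "2 * s + z\<^sup>2 > 0" using assms by (simp add: add_pos_nonneg)
    moreover have "(2 * s - z\<^sup>2) * (2 * s + z\<^sup>2) \<le> (2 * s)\<^sup>2"
      using zero_le_power2[of "z\<^sup>2"] by (simp add: algebra_simps power2_eq_square)
    ultimately have "(2 * s - z\<^sup>2) / (4 * s\<^sup>2) \<le> 1 / (2 * s + z\<^sup>2)"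
      using assms by (simp add: divide_simps power2_eq_square mult_ac)
    then have "z\<^sup>2 * ((2 * s - z\<^sup>2) / (4 * s\<^sup>2)) \<le> z\<^sup>2 * (1 / (2 * s + z\<^sup>2))"
      by (intro mult_left_mono) auto
    moreover have "z\<^sup>2 * ((2 * s - z\<^sup>2) / (4 * s\<^sup>2)) = z\<^sup>2 / (2 * s) - z ^ 4 / (4 * s\<^sup>2)"
      using assms by (simp add: field_simps power2_eq_square power4_eq_xxxx)
    ultimately show "z\<^sup>2 / (2 * s) - z ^ 4 / (4 * s\<^sup>2) \<le> z\<^sup>2 / (2 * s + z\<^sup>2)" by simp
  qed (use assms integrable_std_normal_power[of 2] integrable_std_normal_power[of 4] integrable_deficit in auto)
  finally show ?thesis .
qed

text \<open>The inequality \<open>ln u \<ge> 1 - 1 / u\<close> gives \<open>log_mean s \<ge> deficit s\<close>.\<close>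

lemma log_mean_lower:
  assumes "s > 0" shows "log_mean s \<ge> 1 / (2 * s) - 3 / (4 * s\<^sup>2)"
proof -
  have "1 / (2 * s) - 3 / (4 * s\<^sup>2) \<le> deficit s" by (rule deficit_lower[OF assms])
  also have "\<dots> \<le> log_mean s"
    unfolding deficit_def log_mean_def
  proof (rule integral_mono)
    fix z :: real
    have p: "1 + z\<^sup>2 / (2 * s) > 0" using assms by (simp add: add_pos_nonneg)
    have "z\<^sup>2 / (2 * s + z\<^sup>2) = 1 - 1 / (1 + z\<^sup>2 / (2 * s))"
      using assms by (simp add: divide_simps) (simp add: add_pos_nonneg less_imp_neq[symmetric])
    also have "\<dots> \<le> ln (1 + z\<^sup>2 / (2 * s))"
      using ln_le_minus_one[of "1 / (1 + z\<^sup>2 / (2 * s))"] p by (simp add: ln_div)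
    finally show "z\<^sup>2 / (2 * s + z\<^sup>2) \<le> ln (1 + z\<^sup>2 / (2 * s))" .
  qed (use assms integrable_deficit integrable_log_mean in auto)
  finally show ?thesis .
qed

lemma log_mean_diff_le:
  assumes "0 < s" "s \<le> s'"
  shows "\<bar>log_mean s - log_mean s'\<bar> \<le> 1 / (2 * s) - 1 / (2 * s')"
proof -
  have s': "s' > 0" using assms by simp
  have le: "1 / s' \<le> 1 / s" using assms by (simp add: frac_le)
  have "log_mean s' \<le> log_mean s"
    unfolding log_mean_def
  proof (rule integral_mono)
    fix z :: real
    have "z\<^sup>2 / (2 * s') \<le> z\<^sup>2 / (2 * s)" using assms by (intro divide_left_mono) auto
    moreover have "1 + z\<^sup>2 / (2 * s') > 0" using s' by (simp add: add_pos_nonneg)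
    ultimately show "ln (1 + z\<^sup>2 / (2 * s')) \<le> ln (1 + z\<^sup>2 / (2 * s))"
      by simp
  qed (use assms s' integrable_log_mean in auto)
  moreover have "log_mean s - log_mean s' \<le> (\<integral>z. z\<^sup>2 * (1 / (2 * s) - 1 / (2 * s')) \<partial>std_normal)"
    unfolding log_mean_def
    unfolding Bochner_Integration.integral_diff[OF integrable_log_mean[OF assms(1)] integrable_log_mean[OF s'], symmetric]
  proof (rule integral_mono)
    fix z :: real
    define u v where "u = z\<^sup>2 / (2 * s)" and "v = z\<^sup>2 / (2 * s')"
    have uv: "0 \<le> v" "v \<le> u" using assms s' unfolding u_def v_def by (auto intro: divide_left_mono)
    have "ln (1 + u) - ln (1 + v) = ln ((1 + u) / (1 + v))" using uv by (simp add: ln_div)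
    also have "\<dots> \<le> (1 + u) / (1 + v) - 1" using uv by (intro ln_le_minus_one) simp
    also have "\<dots> = (u - v) / (1 + v)" using uv by (simp add: field_simps)
    also have "\<dots> \<le> (u - v) / 1" using uv by (intro divide_left_mono) auto
    finally show "ln (1 + z\<^sup>2 / (2 * s)) - ln (1 + z\<^sup>2 / (2 * s')) \<le> z\<^sup>2 * (1 / (2 * s) - 1 / (2 * s'))"
      by (simp add: u_def v_def algebra_simps)
  qed (use assms s' integrable_log_mean integrable_std_normal_power[of 2] in auto)
  ultimately show ?thesis
    by (simp add: std_normal_moment2)
qed

lemma log_mean_continuous:
  assumes "s > 0" shows "isCont log_mean s"
proof -
  have "((\<lambda>x. log_mean x - log_mean s) \<longlongrightarrow> 0) (at s)"
  proof (rule Lim_null_comparison)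
    have "eventually (\<lambda>x. x > 0) (at s)"
      using assms by (auto intro!: order_tendstoD tendsto_ident_at)
    then show "\<forall>\<^sub>F x in at s. norm (log_mean x - log_mean s) \<le> \<bar>1 / (2 * s) - 1 / (2 * x)\<bar>"
    proof eventually_elim
      case (elim x)
      then show ?case using log_mean_diff_le[of x s] log_mean_diff_le[of s x] assms
        by (cases "x \<le> s") auto
    qed
    show "((\<lambda>x. \<bar>1 / (2 * s) - 1 / (2 * x)\<bar>) \<longlongrightarrow> 0) (at s)"
      using assms by (auto intro!: tendsto_eq_intros)
  qed
  then show ?thesis by (simp add: isCont_def LIM_zero_iff)
qed

lemma balance_upper:
  assumes "s > 3 / 2" shows "balance s \<le> 2 * s\<^sup>2 / (2 * s - 3)"
proof -
  have "1 / (2 * s) - 3 / (4 * s\<^sup>2) = (2 * s - 3) / (4 * s\<^sup>2)"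
    using assms by (simp add: field_simps power2_eq_square)
  moreover have "(2 * s - 3) / (4 * s\<^sup>2) > 0" using assms by simp
  ultimately have "1 / deficit s \<le> 1 / ((2 * s - 3) / (4 * s\<^sup>2))"
    using deficit_lower[of s] deficit_pos[of s] assms by (intro divide_left_mono mult_pos_pos) auto
  also have "\<dots> = 2 * (2 * s\<^sup>2 / (2 * s - 3))" by simp
  finally have "1 / deficit s \<le> 2 * (2 * s\<^sup>2 / (2 * s - 3))" .
  then have "1 / deficit s - 1 \<le> 2 * (2 * s\<^sup>2 / (2 * s - 3))" by simp
  then show ?thesis unfolding balance_def by (subst pos_divide_le_eq) (simp_all add: mult.commute)
qed

lemma balance_asymp: "((\<lambda>s. balance s / s) \<longlongrightarrow> 1) at_top"
proof (rule tendsto_sandwich)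
  show "\<forall>\<^sub>F s in at_top. 1 \<le> balance s / s"
    using eventually_gt_at_top[of 0] by eventually_elim (simp add: balance_ge)
  show "\<forall>\<^sub>F s in at_top. balance s / s \<le> 2 * s\<^sup>2 / (2 * s - 3) / s"
    using eventually_gt_at_top[of "3/2"]
    by eventually_elim (intro divide_right_mono balance_upper, auto)
  show "((\<lambda>s::real. 2 * s\<^sup>2 / (2 * s - 3) / s) \<longlongrightarrow> 1) at_top" by real_asymp
qed simp

text \<open>Equivalent to \<open>balance s\<close> tending to 0 with \<open>s\<close>: the mean of \<open>1 / (1 + Z\<^sup>2 / (2 s))\<close> is at most
  \<open>P(\<bar>Z\<bar> \<le> d) + 2 s / d\<^sup>2\<close>. It keeps \<open>s\<close> away from 0 while \<open>s\<close> decreases along the flow.\<close>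

lemma balance_small:
  assumes "x > 0"
  obtains c where "c > 0" "\<And>s. s > 0 \<Longrightarrow> x \<le> balance s \<Longrightarrow> c \<le> s"
proof -
  define h where "h = 1 - 1 / (2 * x + 1)"
  have h: "h > 0" using assms by (simp add: h_def)
  define d where "d = h / 2"
  have d: "d > 0" using h by (simp add: d_def)
  have P: "measure std_normal {-d..d} \<le> d"
  proof -
    have dens: "std_normal_density z \<le> 1 / 2" for z
    proof -
      have "sqrt (2 * pi) \<ge> 2" using pi_ge_two by (intro real_le_rsqrt) simp
      then have "1 / sqrt (2 * pi) \<le> 1 / 2" by (intro divide_left_mono) auto
      moreover have "exp (- z\<^sup>2 / 2) \<le> 1" by simp
      ultimately have "1 / sqrt (2 * pi) * exp (- z\<^sup>2 / 2) \<le> 1 / 2 * 1" by (intro mult_mono) auto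
      then show ?thesis by (simp add: std_normal_density_def)
    qed
    have "measure std_normal {-d..d} = (\<integral>z. indicator {-d..d} z \<partial>std_normal)" by simp
    also have "\<dots> = (\<integral>z. std_normal_density z * indicator {-d..d} z \<partial>lborel)"
      by (rule std_normal_integral) simp
    also have "\<dots> \<le> (\<integral>z. 1 / 2 * indicator {-d..d} z \<partial>lborel)"
    proof (rule integral_mono)
      show "integrable lborel (\<lambda>z. std_normal_density z * indicator {-d..d} z)"
        by (rule integrable_real_mult_indicator) auto
      show "integrable lborel (\<lambda>z. 1 / 2 * indicator {-d..d} z :: real)"
        by (intro integrable_mult_right integrable_real_indicator) (auto simp: emeasure_lborel_Icc_eq)
      show "std_normal_density z * indicator {-d..d} z \<le> 1 / 2 * indicator {-d..d} z" for z
        by (rule mult_right_mono[OF dens]) simp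
    qed
    also have "\<dots> = d" using d by simp
    finally show ?thesis .
  qed
  show thesis
  proof (rule that)
    show "h * d\<^sup>2 / 4 > 0" using h d by simp
    fix s :: real assume s: "s > 0" "x \<le> balance s"
    have "1 - deficit s \<le> (\<integral>z. indicator {-d..d} z + 2 * s / d\<^sup>2 \<partial>std_normal)"
      unfolding weight_mean(2)[OF s(1), symmetric]
    proof (rule integral_mono)
      fix z :: real
      have le1: "1 / (1 + z\<^sup>2 / (2 * s)) \<le> 1" using s by (simp add: divide_simps add_pos_nonneg)
      have e: "2 * s / d\<^sup>2 \<ge> 0" using s by simp
      show "1 / (1 + z\<^sup>2 / (2 * s)) \<le> indicator {-d..d} z + 2 * s / d\<^sup>2"
      proof (cases "z \<in> {-d..d}")
        case True
        then have "indicator {-d..d} z = (1::real)" by simp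
        with le1 e show ?thesis by linarith
      next
        case False
        then have "d\<^sup>2 \<le> z\<^sup>2" using d by (auto intro: abs_le_square_iff[THEN iffD1])
        moreover have "1 / (1 + z\<^sup>2 / (2 * s)) = 2 * s / (2 * s + z\<^sup>2)"
          using s by (simp add: divide_simps)
        moreover have "d\<^sup>2 > 0" using d by simp
        ultimately have "1 / (1 + z\<^sup>2 / (2 * s)) \<le> 2 * s / d\<^sup>2"
          using s by (auto intro!: divide_left_mono mult_pos_pos add_pos_nonneg)
        then show ?thesis using False by simp
      qed
    next
      show "integrable std_normal (\<lambda>z. 1 / (1 + z\<^sup>2 / (2 * s)))" by (rule weight_mean(1)[OF s(1)])
      show "integrable std_normal (\<lambda>z. indicator {-d..d} z + 2 * s / d\<^sup>2)"
        by (rule Bochner_Integration.integrable_add) (auto simp: less_top[symmetric])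
    qed
    also have "\<dots> \<le> d + 2 * s / d\<^sup>2"
    proof -
      have "integrable std_normal (indicator {-d..d} :: real \<Rightarrow> real)"
        by (rule std_normal.integrable_const_bound[where B = 1]) auto
      then show ?thesis using P std_normal.prob_space by simp
    qed
    finally have "1 - deficit s \<le> d + 2 * s / d\<^sup>2" .
    moreover have "deficit s \<le> 1 / (2 * x + 1)"
    proof -
      have "deficit s = 1 / (2 * balance s + 1)"
        using deficit_balance[OF s(1)] balance_pos[OF s(1)] by (simp add: field_simps)
      also have "\<dots> \<le> 1 / (2 * x + 1)" using s assms by (intro divide_left_mono) auto
      finally show ?thesis .
    qed
    ultimately have "h \<le> h / 2 + 2 * s / d\<^sup>2" by (simp add: h_def d_def)
    then have "h / 2 * d\<^sup>2 \<le> 2 * s" using d by (simp add: field_simps)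
    then show "h * d\<^sup>2 / 4 \<le> s" by simp
  qed
qed

section \<open>Student densities and the digamma function\<close>

definition digamma_gap :: "real \<Rightarrow> real" where
  "digamma_gap x = Digamma (x + 1 / 2) - Digamma x"

text \<open>The substitution \<open>z\<^sup>2 / (2 s) = t / (1 - t)\<close> turns the integral into Euler's integral for
  \<open>Beta (1/2) x\<close>.\<close>

lemma student_integral_half_line:
  fixes s x :: real
  assumes "s > 0" "x > 0"
  shows "has_bochner_integral lborel
           (\<lambda>z. indicator {0..} z *\<^sub>R (1 / (1 + z\<^sup>2 / (2 * s))) powr (x + 1 / 2))
           (sqrt (2 * s) * Beta x (1 / 2) / 2)"
proof -
  define f where "f = (\<lambda>z::real. (1 / (1 + z\<^sup>2 / (2 * s))) powr (x + 1 / 2))"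
  define g where "g = (\<lambda>t::real. sqrt (2 * s) * sqrt (t / (1 - t)))"
  define g' where "g' = (\<lambda>t::real. sqrt (2 * s) * (1 / (2 * sqrt (t / (1 - t))) * (1 / (1 - t)\<^sup>2)))"
  define b where "b = (\<lambda>t::real. sqrt (2 * s) / 2 * (t powr (1 / 2 - 1) * (1 - t) powr (x - 1)))"
  have fg: "f (g t) * g' t = b t" if "0 < t" "t < 1" for t
  proof -
    have *: "(g t)\<^sup>2 / (2 * s) = t / (1 - t)"
      using that assms by (simp add: g_def power_mult_distrib)
    have "1 / (1 + (g t)\<^sup>2 / (2 * s)) = 1 - t"
    proof -
      have "1 + t / (1 - t) = 1 / (1 - t)" using that by (simp add: field_simps)
      with * show ?thesis by simp
    qed
    then have "f (g t) = (1 - t) powr (x + 1 / 2)" by (simp add: f_def)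
    moreover have "g' t = sqrt (2 * s) / 2 * (t powr (- 1 / 2) * (1 - t) powr (- 3 / 2))"
    proof -
      have "1 / sqrt (t / (1 - t)) = t powr (- 1 / 2) * (1 - t) powr (1 / 2)"
        using that by (simp add: real_sqrt_divide powr_half_sqrt[symmetric] powr_minus_divide)
      moreover have "1 / (1 - t)\<^sup>2 = (1 - t) powr (- 2)"
        using that by (simp add: powr_minus_divide)
      moreover have "(1 - t) powr (1 / 2) * (1 - t) powr (- 2) = (1 - t) powr (- 3 / 2)"
        using that by (simp flip: powr_add)
      moreover have "g' t = sqrt (2 * s) / 2 * (1 / sqrt (t / (1 - t)) * (1 / (1 - t)\<^sup>2))"
        by (simp add: g'_def)
      ultimately show ?thesis by (simp only: mult.assoc)
    qed
    ultimately have "f (g t) * g' t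
        = sqrt (2 * s) / 2 * (t powr (- 1 / 2) * ((1 - t) powr (x + 1 / 2) * (1 - t) powr (- 3 / 2)))"
      by simp
    also have "(1 - t) powr (x + 1 / 2) * (1 - t) powr (- 3 / 2) = (1 - t) powr (x - 1)"
      using that by (simp flip: powr_add)
    finally show ?thesis by (simp add: b_def)
  qed
  have b_int: "set_integrable lborel {0<..<1} b"
  proof -
    have "set_integrable lborel {0..1} b"
      unfolding b_def using integrable_Beta[of "1 / 2" x] assms by (intro set_integrable_mult_right) simp
    then show ?thesis by (rule set_integrable_subset) auto
  qed
  have e01: "einterval 0 1 = {0<..<1::real}"
    by (auto simp: einterval_def zero_ereal_def one_ereal_def)
  have e0i: "einterval 0 \<infinity> = {0::real<..}"
    by (auto simp: einterval_def zero_ereal_def)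
  have sub1: "set_integrable lborel (einterval 0 \<infinity>) f"
    and sub2: "(LBINT z=0..\<infinity>. f z) = (LBINT t=0..1. f (g t) * g' t)"
  proof -
    have p1: "(0::ereal) < 1" by simp
    have p2: "DERIV g t :> g' t" if "0 < ereal t" "ereal t < 1" for t
      using that assms unfolding g_def g'_def zero_ereal_def one_ereal_def
      by (auto intro!: derivative_eq_intros simp: divide_simps power2_eq_square)
    have p3: "isCont f (g t)" for t
    proof -
      have "1 + y\<^sup>2 / (2 * s) > 0" for y :: real using assms by (simp add: add_pos_nonneg)
      then show ?thesis unfolding f_def
        using assms by (intro continuous_intros) (auto simp: less_imp_neq[symmetric])
    qed
    have p4: "isCont g' t" if "0 < ereal t" "ereal t < 1" for t
      using that assms unfolding g'_def zero_ereal_def one_ereal_def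
      by (auto intro!: continuous_intros)
    have p5: "0 \<le> f (g t)" for t by (simp add: f_def)
    have p6: "0 \<le> g' t" if "0 \<le> ereal t" "ereal t \<le> 1" for t
      using that assms unfolding g'_def zero_ereal_def one_ereal_def by simp
    have p7: "((ereal \<circ> g \<circ> real_of_ereal) \<longlongrightarrow> 0) (at_right 0)"
    proof -
      have "(g \<longlongrightarrow> 0) (at_right 0)" unfolding g_def using assms by real_asymp
      then show ?thesis unfolding zero_ereal_def by (simp add: ereal_tendsto_simps)
    qed
    have p8: "((ereal \<circ> g \<circ> real_of_ereal) \<longlongrightarrow> \<infinity>) (at_left 1)"
    proof -
      have "filterlim g at_top (at_left 1)" unfolding g_def using assms by real_asymp
      then show ?thesis unfolding one_ereal_def
        by (simp add: ereal_tendsto_simps)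
    qed
    have p9: "set_integrable lborel (einterval 0 1) (\<lambda>t. f (g t) * g' t)"
      using b_int fg unfolding e01
      by (subst set_integrable_cong[OF refl refl, of _ _ b]) auto
    show "set_integrable lborel (einterval 0 \<infinity>) f"
      by (rule interval_integral_substitution_nonneg(1)[OF p1 p2 p3 p4 p5 p6 p7 p8 p9])
    show "(LBINT z=0..\<infinity>. f z) = (LBINT t=0..1. f (g t) * g' t)"
      by (rule interval_integral_substitution_nonneg(2)[OF p1 p2 p3 p4 p5 p6 p7 p8 p9])
  qed
  have "(LBINT t=0..1. f (g t) * g' t) = (LBINT t:{0<..<1}. b t)"
    unfolding interval_lebesgue_integral_def e01 using fg
    by (auto intro!: set_lebesgue_integral_cong)
  also have "\<dots> = integral {0<..<1} b"
    by (rule set_borel_integral_eq_integral(2)[OF b_int])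
  also have "\<dots> = sqrt (2 * s) / 2 * Beta (1 / 2) x"
  proof (rule integral_unique)
    have "(b has_integral sqrt (2 * s) / 2 * Beta (1 / 2) x) {0..1}"
      unfolding b_def using has_integral_Beta_real[of "1 / 2" x] assms
      by (intro has_integral_mult_right) simp
    then show "(b has_integral sqrt (2 * s) / 2 * Beta (1 / 2) x) {0<..<1}"
      by (simp add: has_integral_Icc_iff_Ioo)
  qed
  finally have val: "(LBINT z=0..\<infinity>. f z) = sqrt (2 * s) * Beta x (1 / 2) / 2"
    using sub2 by (simp add: Beta_commute)
  have "has_bochner_integral lborel (\<lambda>z. indicator {0<..} z *\<^sub>R f z) (sqrt (2 * s) * Beta x (1 / 2) / 2)"
    using sub1 val unfolding e0i set_integrable_def has_bochner_integral_iff
    by (simp add: interval_lebesgue_integral_def e0i set_lebesgue_integral_def)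
  moreover have "AE z in lborel. indicator {0<..} z *\<^sub>R f z = indicator {0..} z *\<^sub>R f z"
    using AE_lborel_singleton[of "0::real"] by eventually_elim (auto simp: indicator_def)
  ultimately show ?thesis
    unfolding f_def by (subst (asm) has_bochner_integral_cong_AE) auto
qed

lemma student_integral:
  fixes s x :: real
  assumes "s > 0" "x > 0"
  shows "has_bochner_integral lborel (\<lambda>z. (1 / (1 + z\<^sup>2 / (2 * s))) powr (x + 1 / 2))
           (sqrt (2 * s) * Beta x (1 / 2))"
  using has_bochner_integral_even_function[OF student_integral_half_line[OF assms]] by simp

lemma powr_ge_tangent:
  fixes w :: real assumes "w > 0"
  shows "w powr (k + h) \<ge> w powr k * (1 + h * ln w)"
proof -
  have "w powr (k + h) = w powr k * exp (h * ln w)"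
    using assms by (simp add: powr_def distrib_right exp_add)
  then show ?thesis using exp_ge_add_one_self[of "h * ln w"] by (simp add: mult_left_mono)
qed

text \<open>The integral is minus the derivative of \<open>J y = sqrt (2 s) * Beta y (1/2)\<close> at \<open>y = x\<close>. Instead of
  differentiating under the integral sign, integrate the tangent inequality of \<open>powr_ge_tangent\<close>: the
  function \<open>J y - J x + (y - x) L\<close>, where \<open>L\<close> is the integral, is nonnegative and vanishes at \<open>x\<close>, so
  its derivative there is 0.\<close>

lemma student_log_integral:
  fixes s x :: real
  assumes "s > 0" "x > 0"
  shows "has_bochner_integral lborel
           (\<lambda>z. ln (1 + z\<^sup>2 / (2 * s)) * (1 / (1 + z\<^sup>2 / (2 * s))) powr (x + 1 / 2))
           (sqrt (2 * s) * Beta x (1 / 2) * digamma_gap x)"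
proof -
  define w where "w = (\<lambda>z::real. 1 / (1 + z\<^sup>2 / (2 * s)))"
  define J where "J = (\<lambda>y. sqrt (2 * s) * Beta y (1 / 2))"
  define l where "l = (\<lambda>z. ln (1 + z\<^sup>2 / (2 * s)) * w z powr (x + 1 / 2))"
  have w: "w z > 0" "w z \<le> 1" for z
    using assms by (auto simp: w_def add_pos_nonneg divide_simps)
  have lnw: "ln (1 + z\<^sup>2 / (2 * s)) = - ln (w z)" for z
    using assms by (simp add: w_def ln_div add_pos_nonneg)
  have J: "has_bochner_integral lborel (\<lambda>z. w z powr (y + 1 / 2)) (J y)" if "y > 0" for y
    unfolding w_def J_def by (rule student_integral[OF assms(1) that])
  have meas: "l \<in> borel_measurable lborel" unfolding l_def w_def by measurable
  have l0: "0 \<le> l z" for z unfolding l_def lnw using w[of z]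
    by (intro mult_nonneg_nonneg) auto
  \<comment> \<open>the logarithm is absorbed by half of the decay exponent \<open>x\<close>\<close>
  have bound: "l z \<le> 2 / x * w z powr (x / 2 + 1 / 2)" for z
  proof -
    have "w z powr (x + 1 / 2) * (1 + - x / 2 * ln (w z)) \<le> w z powr (x / 2 + 1 / 2)"
    proof -
      have "x + 1 / 2 + - x / 2 = x / 2 + 1 / 2" by (simp add: field_simps)
      then show ?thesis using powr_ge_tangent[OF w(1), of z "x + 1 / 2" "- x / 2"] by (simp only:)
    qed
    then have "x / 2 * l z \<le> w z powr (x / 2 + 1 / 2)"
      using powr_ge_zero[of "w z" "x + 1 / 2"] unfolding l_def lnw distrib_left
      by (simp add: mult_ac del: powr_ge_zero powr_nonneg_iff)
    then show ?thesis using assms by (simp add: field_simps)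
  qed
  have int: "integrable lborel l"
  proof (rule Bochner_Integration.integrable_bound)
    show "integrable lborel (\<lambda>z. 2 / x * w z powr (x / 2 + 1 / 2))"
      using J[of "x / 2"] assms by (intro integrable_mult_right) (auto simp: has_bochner_integral_iff)
    show "AE z in lborel. norm (l z) \<le> norm (2 / x * w z powr (x / 2 + 1 / 2))"
      using bound l0 assms by (intro AE_I2) simp
  qed (rule meas)
  define L where "L = integral\<^sup>L lborel l"
  have ge: "J y - J x + (y - x) * L \<ge> 0" if "y > 0" for y
  proof -
    have "0 \<le> (\<integral>z. w z powr (y + 1 / 2) - w z powr (x + 1 / 2) + (y - x) * l z \<partial>lborel)"
    proof (rule integral_nonneg_AE, rule AE_I2)
      fix z
      show "0 \<le> w z powr (y + 1 / 2) - w z powr (x + 1 / 2) + (y - x) * l z"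
        using powr_ge_tangent[OF w(1), of z "x + 1 / 2" "y - x"] unfolding l_def lnw
        by (simp add: algebra_simps)
    qed
    also have "\<dots> = J y - J x + (y - x) * L"
      using J[OF that] J[OF assms(2)] int by (simp add: has_bochner_integral_iff L_def)
    finally show ?thesis .
  qed
  have "((\<lambda>y. J y - J x + (y - x) * L) has_real_derivative
          (sqrt (2 * s) * (Beta x (1 / 2) * (Digamma x - Digamma (x + 1 / 2))) + L)) (at x)"
    unfolding J_def using assms
    by (auto intro!: derivative_eq_intros elim!: nonpos_Ints_cases)
  then have "sqrt (2 * s) * (Beta x (1 / 2) * (Digamma x - Digamma (x + 1 / 2))) + L = 0"
  proof (rule DERIV_local_min)
    show "x > 0" by (rule assms)
    show "\<forall>y. \<bar>x - y\<bar> < x \<longrightarrow> J x - J x + (x - x) * L \<le> J y - J x + (y - x) * L"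
      using ge by auto
  qed
  then have "L = sqrt (2 * s) * Beta x (1 / 2) * digamma_gap x"
    by (simp add: digamma_gap_def algebra_simps)
  with int show ?thesis unfolding has_bochner_integral_iff l_def w_def L_def by simp
qed

section \<open>Comparing the normal and the Student law\<close>

text \<open>A function that first falls and then rises is negative exactly between its zeros. Two such functions
  with the same zeros thus have equal signs; \<open>log_chord\<close> uses this.\<close>

lemma valley_sign:
  fixes f :: "real \<Rightarrow> real"
  assumes dec: "\<And>x y. 0 < x \<Longrightarrow> x < y \<Longrightarrow> y \<le> m \<Longrightarrow> f y < f x"
    and inc: "\<And>x y. m \<le> x \<Longrightarrow> x < y \<Longrightarrow> f x < f y"
    and ab: "0 < a" "a < b" "f a = 0" "f b = 0"
    and x: "0 < x" "x \<noteq> a" "x \<noteq> b"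
  shows "f x < 0 \<longleftrightarrow> a < x \<and> x < b" and "f x \<noteq> 0"
proof -
  have am: "a < m" using inc[of a b] ab by (rule_tac ccontr) auto
  have bm: "m < b" using dec[of a b] ab by (rule_tac ccontr) auto
  consider "x < a" | "a < x" "x \<le> m" | "m \<le> x" "x < b" | "b < x" using x by linarith
  then have "(f x < 0 \<longleftrightarrow> a < x \<and> x < b) \<and> f x \<noteq> 0"
  proof cases
    case 1 then show ?thesis using dec[of x a] x am ab by auto
  next
    case 2 then show ?thesis using dec[of a x] x am bm ab by auto
  next
    case 3 then show ?thesis using inc[of x b] x am bm ab by auto
  next
    case 4 then show ?thesis using inc[of b x] x am bm ab by auto
  qed
  then show "f x < 0 \<longleftrightarrow> a < x \<and> x < b" "f x \<noteq> 0" by auto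
qed

lemma valley_from_derivative:
  fixes f f' :: "real \<Rightarrow> real"
  assumes "m > 0"
    and D: "\<And>x. 0 < x \<Longrightarrow> (f has_real_derivative f' x) (at x)"
    and neg: "\<And>x. 0 < x \<Longrightarrow> x < m \<Longrightarrow> f' x < 0" and pos: "\<And>x. m < x \<Longrightarrow> 0 < f' x"
  shows "\<And>x y. 0 < x \<Longrightarrow> x < y \<Longrightarrow> y \<le> m \<Longrightarrow> f y < f x"
    and "\<And>x y. m \<le> x \<Longrightarrow> x < y \<Longrightarrow> f x < f y"
proof -
  have cont: "continuous_on {x..y} f" if "0 < x" for x y
  proof (rule continuous_at_imp_continuous_on, rule ballI)
    fix u assume "u \<in> {x..y}"
    then have "u > 0" using that by simp
    from D[OF this] show "isCont f u" by (rule DERIV_isCont)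
  qed
  show "f y < f x" if "0 < x" "x < y" "y \<le> m" for x y
  proof (rule DERIV_neg_imp_decreasing_open[OF that(2) _ cont[OF that(1)]])
    fix u assume "x < u" "u < y"
    then show "\<exists>d. (f has_real_derivative d) (at u) \<and> d < 0"
      using that by (intro exI[of _ "f' u"] conjI D neg) auto
  qed
  show "f x < f y" if "m \<le> x" "x < y" for x y
  proof (rule DERIV_pos_imp_increasing_open[OF that(2) _ cont])
    fix u assume "x < u" "u < y"
    then show "\<exists>d. (f has_real_derivative d) (at u) \<and> 0 < d"
      using that assms(1) by (intro exI[of _ "f' u"] conjI D pos) auto
  qed (use that assms(1) in simp)
qed

text \<open>The second factor is the logarithm of a density ratio. It is positive on an interval (or nowhere),
  and the affine function is the chord of \<open>- ln\<close> over that interval, or the tangent to \<open>- ln\<close> at the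
  point where the ratio is largest, when it is nowhere positive; by convexity \<open>- ln\<close> lies below the chord
  inside and above it outside. The
  interval may reach beyond 1, the upper end of the values of \<open>w\<close> to which this is applied, and then
  the statement still holds, so the actual number of crossings never has to be determined.\<close>

lemma log_chord:
  fixes c s k :: real
  assumes "s > 0" "k > 0"
  obtains p r :: real and N :: "real set" where "finite N"
    "\<And>w. w > 0 \<Longrightarrow> w \<notin> N \<Longrightarrow> (- ln w - (p + r * w)) * (c - s / w - k * ln w) < 0"
proof -
  define m where "m = s / k"
  have m: "m > 0" using assms by (simp add: m_def)
  define u where "u = (\<lambda>w. s / w + k * ln w - c)"
  have Du: "(u has_real_derivative (k * w - s) / w\<^sup>2) (at w)" if "w > 0" for w
    unfolding u_def using that by (auto intro!: derivative_eq_intros simp: field_simps power2_eq_square)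
  have "(k * w - s) / w\<^sup>2 < 0" if "0 < w" "w < m" for w
    using that assms by (simp add: m_def field_simps)
  moreover have "0 < (k * w - s) / w\<^sup>2" if "m < w" for w
  proof -
    have "w > 0" using that m by linarith
    then show ?thesis using that assms by (simp add: m_def field_simps)
  qed
  ultimately have udec: "\<And>x y. 0 < x \<Longrightarrow> x < y \<Longrightarrow> y \<le> m \<Longrightarrow> u y < u x"
    and uinc: "\<And>x y. m \<le> x \<Longrightarrow> x < y \<Longrightarrow> u x < u y"
    using valley_from_derivative[OF m Du] by blast+
  define v where "v = (\<lambda>p r w::real. - ln w - (p + r * w))"
  have vdec: "\<And>x y. 0 < x \<Longrightarrow> x < y \<Longrightarrow> y \<le> - 1 / r \<Longrightarrow> v p r y < v p r x"
    and vinc: "\<And>x y. - 1 / r \<le> x \<Longrightarrow> x < y \<Longrightarrow> v p r x < v p r y" if "r < 0" for p r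
  proof -
    have "(v p r has_real_derivative - 1 / w - r) (at w)" if "w > 0" for w
      unfolding v_def using that by (auto intro!: derivative_eq_intros simp: field_simps)
    moreover have "- 1 / w - r < 0" if "0 < w" "w < - 1 / r" for w
      using that \<open>r < 0\<close> by (simp add: field_simps)
    moreover have "0 < - 1 / w - r" if "- 1 / r < w" for w
    proof -
      have "0 < - 1 / r" using \<open>r < 0\<close> by simp
      then have "w > 0" using that by linarith
      then show ?thesis using that \<open>r < 0\<close> by (simp add: field_simps)
    qed
    moreover have "- 1 / r > 0" using \<open>r < 0\<close> by simp
    ultimately show "\<And>x y. 0 < x \<Longrightarrow> x < y \<Longrightarrow> y \<le> - 1 / r \<Longrightarrow> v p r y < v p r x"
      "\<And>x y. - 1 / r \<le> x \<Longrightarrow> x < y \<Longrightarrow> v p r x < v p r y"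
      using valley_from_derivative[of "- 1 / r" "v p r" "\<lambda>w. - 1 / w - r"] by blast+
  qed
  have goal: "(- ln w - (p + r * w)) * (c - s / w - k * ln w) = - (v p r w * u w)" for p r w
    by (simp add: v_def u_def algebra_simps)
  show thesis
  proof (cases "u m \<ge> 0")
    case True
    define r where "r = - 1 / m"
    define p where "p = - ln m - r * m"
    have r: "r < 0" "- 1 / r = m" using m by (auto simp: r_def)
    have vm: "v p r m = 0" by (simp add: v_def p_def)
    show thesis
    proof (rule that[of "{m}" p r])
      fix w :: real assume w: "w > 0" "w \<notin> {m}"
      then consider "w < m" | "m < w" by fastforce
      then have "v p r w > 0 \<and> u w > 0"
      proof cases
        case 1
        then show ?thesis using udec[of w m] vdec[of r w m p] w r vm True by simp
      next
        case 2
        then show ?thesis using uinc[of m w] vinc[of r m w p] w r vm True by simp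
      qed
      then show "(- ln w - (p + r * w)) * (c - s / w - k * ln w) < 0"
        unfolding goal by simp
    qed simp
  next
    case False
    have ucont: "isCont u w" if "w > 0" for w using Du[OF that] by (rule DERIV_isCont)
    have "filterlim u at_top (at_right 0)" unfolding u_def using assms by real_asymp
    then have "eventually (\<lambda>w. u w > 0 \<and> w < m \<and> w > 0) (at_right 0)"
      using m by (intro eventually_conj) (auto simp: filterlim_at_top_dense eventually_at_right_less
          intro: eventually_at_rightI[of 0 m])
    then obtain w0 where w0: "u w0 > 0" "w0 < m" "w0 > 0"
      using eventually_happens trivial_limit_at_right_real by blast
    have "\<exists>w\<ge>w0. w \<le> m \<and> u w = 0"
      by (rule IVT2) (use w0 False in \<open>auto intro: ucont\<close>)
    then obtain a where a: "w0 \<le> a" "a \<le> m" "u a = 0" by blast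
    have "filterlim u at_top at_top" unfolding u_def using assms by real_asymp
    then have "eventually (\<lambda>w. u w > 0 \<and> w > m) at_top"
      by (intro eventually_conj) (auto simp: filterlim_at_top_dense eventually_gt_at_top)
    then obtain w1 where w1: "u w1 > 0" "w1 > m"
      using eventually_happens trivial_limit_at_top_linorder by blast
    have "\<exists>w\<ge>m. w \<le> w1 \<and> u w = 0"
      by (rule IVT) (use w1 m False in \<open>auto intro: ucont\<close>)
    then obtain b where b: "m \<le> b" "b \<le> w1" "u b = 0" by blast
    have ab: "0 < a" "a < b" using a b w0 False by (auto simp: order_le_less)
    define r where "r = - (ln b - ln a) / (b - a)"
    define p where "p = - ln a - r * a"
    have r: "r < 0" using ab by (simp add: r_def divide_neg_pos)
    have "r * (b - a) = - (ln b - ln a)" using ab by (simp add: r_def)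
    then have v0: "v p r a = 0" "v p r b = 0" by (simp_all add: v_def p_def algebra_simps)
    show thesis
    proof (rule that[of "{a, b}" p r])
      fix w :: real assume w: "w > 0" "w \<notin> {a, b}"
      have "u w < 0 \<longleftrightarrow> a < w \<and> w < b" "u w \<noteq> 0"
        using valley_sign[where m = m and f = u and x = w, OF udec uinc ab a(3) b(3)] w by auto
      moreover have "v p r w < 0 \<longleftrightarrow> a < w \<and> w < b" "v p r w \<noteq> 0"
        using valley_sign[where m = "- 1 / r" and f = "v p r" and x = w, OF vdec[OF r] vinc[OF r] ab v0] w
        by auto
      ultimately have "v p r w * u w > 0" by (metis linorder_neqE_linordered_idom mult_neg_neg mult_pos_pos)
      then show "(- ln w - (p + r * w)) * (c - s / w - k * ln w) < 0"
        unfolding goal by simp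
    qed simp
  qed
qed

text \<open>Let \<open>n\<close> and \<open>q\<close> be the normal and the Student density, \<open>w = 1 / (1 + z\<^sup>2 / (2 s))\<close> and \<open>p + r w\<close> the
  affine function of \<open>log_chord\<close> for \<open>ln (n / q) = c - s / w - k ln w\<close>. The integral of
  \<open>(- ln w - p - r w) (n - q)\<close> is negative. Both densities have mass 1 and, by the choice of \<open>x\<close>, the
  same mean of \<open>w\<close>, so the affine part contributes nothing and the integral is
  \<open>log_mean s - digamma_gap x\<close>.\<close>

lemma log_mean_less_digamma_gap:
  assumes s: "s > 0"
  shows "log_mean s < digamma_gap (balance s)"
proof -
  define x where "x = balance s"
  have x: "x > 0" using balance_pos[OF s] by (simp add: x_def)
  define k where "k = x + 1 / 2"
  have k: "k > 0" using x by (simp add: k_def)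
  define w where "w = (\<lambda>z::real. 1 / (1 + z\<^sup>2 / (2 * s)))"
  define J where "J = (\<lambda>y. sqrt (2 * s) * Beta y (1 / 2))"
  define n where "n = std_normal_density"
  define q where "q = (\<lambda>z. w z powr k / J x)"
  have w: "w z > 0" for z
    using assms by (auto simp: w_def add_pos_nonneg)
  have lnw: "ln (1 + z\<^sup>2 / (2 * s)) = - ln (w z)" for z
    using assms by (simp add: w_def ln_div add_pos_nonneg)
  have Jpos: "J y > 0" if "y > 0" for y
    using that s by (simp add: J_def Beta_altdef Gamma_real_pos rGamma_inverse_Gamma)
  have J: "has_bochner_integral lborel (\<lambda>z. w z powr (y + 1 / 2)) (J y)" if "y > 0" for y
    unfolding w_def J_def by (rule student_integral[OF s that])
  have q0: "has_bochner_integral lborel q 1"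
    using has_bochner_integral_divide_zero[OF J[OF x], of "J x"] Jpos[OF x]
    by (simp add: q_def k_def)
  have q1: "has_bochner_integral lborel (\<lambda>z. w z * q z) (2 * x / (2 * x + 1))"
  proof -
    have "(x + 1 / 2) * J (x + 1) = x * J x"
    proof -
      have "x \<notin> \<int>\<^sub>\<le>\<^sub>0" using x by (auto elim!: nonpos_Ints_cases)
      then show ?thesis using Beta_plus1_left[of x "1 / 2"] unfolding J_def
        by (simp add: mult.left_commute)
    qed
    then have "J (x + 1) / J x = 2 * x / (2 * x + 1)"
      using Jpos[OF x] x by (simp add: field_simps)
    moreover have "w z * q z = w z powr (x + 1 + 1 / 2) / J x" for z
    proof -
      have "w z powr (x + 1 + 1 / 2) = w z powr 1 * w z powr k"
        unfolding powr_add[symmetric] k_def by (simp add: add_ac)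
      then show ?thesis using w[of z] by (simp add: q_def)
    qed
    ultimately show ?thesis
      using has_bochner_integral_divide_zero[OF J[of "x + 1"], of "J x"] x by simp
  qed
  have q2: "has_bochner_integral lborel (\<lambda>z. - ln (w z) * q z) (digamma_gap x)"
  proof -
    have "(\<lambda>z. ln (1 + z\<^sup>2 / (2 * s)) * (1 / (1 + z\<^sup>2 / (2 * s))) powr (x + 1 / 2))
        = (\<lambda>z. - ln (w z) * w z powr k)"
      by (rule ext) (simp only: lnw k_def, simp only: w_def)
    then have "has_bochner_integral lborel (\<lambda>z. - ln (w z) * w z powr k) (J x * digamma_gap x)"
      using student_log_integral[OF s x] unfolding J_def by simp
    from has_bochner_integral_divide_zero[OF this, of "J x"] show ?thesis
      using Jpos[OF x] by (simp add: q_def)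
  qed
  have n0: "has_bochner_integral lborel n 1"
    using std_normal_moment_even[of 0] by (simp add: n_def)
  have nI: "has_bochner_integral lborel (\<lambda>z. f z * n z) (integral\<^sup>L std_normal f)"
    if "integrable std_normal f" for f
  proof -
    have "f \<in> borel_measurable borel" using that by (simp add: borel_measurable_integrable[of std_normal, simplified] std_normal_def) 
    then show ?thesis using std_normal_integral[of f] std_normal_integrable_iff[of f] that
      by (simp add: has_bochner_integral_iff n_def mult.commute)
  qed
  have n1: "has_bochner_integral lborel (\<lambda>z. w z * n z) (2 * x / (2 * x + 1))"
  proof -
    have "1 - deficit s = 2 * x / (2 * x + 1)"
      using deficit_balance[OF s] x by (simp add: x_def[symmetric] field_simps)
    then show ?thesis using nI[OF weight_mean(1)[OF s]] weight_mean(2)[OF s] by (simp add: w_def)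
  qed
  have n2: "has_bochner_integral lborel (\<lambda>z. - ln (w z) * n z) (log_mean s)"
    using nI[OF integrable_log_mean[OF s]] unfolding log_mean_def lnw by simp
  \<comment> \<open>normalising constant of the density ratio, since \<open>z\<^sup>2 / 2 = s / w - s\<close>\<close>
  define c where "c = ln (J x / sqrt (2 * pi) * exp s)"
  obtain p r N where N: "finite N"
    and chord: "\<And>w. w > 0 \<Longrightarrow> w \<notin> N \<Longrightarrow> (- ln w - (p + r * w)) * (c - s / w - k * ln w) < 0"
    using log_chord[OF s k, of c] by metis
  define g where "g = (\<lambda>z. (- ln (w z) - (p + r * w z)) * (n z - q z))"
  have gneg: "g z < 0" if "w z \<notin> N" for z
  proof -
    have "s / w z = s + z\<^sup>2 / 2" using s by (simp add: w_def field_simps)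
    moreover have "ln (n z) = - ln (sqrt (2 * pi)) - z\<^sup>2 / 2"
      by (simp add: n_def std_normal_density_def ln_mult ln_div)
    moreover have "ln (q z) = k * ln (w z) - ln (J x)"
      using Jpos[OF x] w[of z] by (simp add: q_def ln_div ln_powr)
    moreover have "c = ln (J x) - ln (sqrt (2 * pi)) + s"
      using Jpos[OF x] by (simp add: c_def ln_mult ln_div)
    ultimately have eq: "c - s / w z - k * ln (w z) = ln (n z) - ln (q z)" by simp
    have "n z > 0" "q z > 0" using Jpos[OF x] w[of z] by (auto simp: n_def q_def normal_density_pos)
    then have "sgn (ln (n z) - ln (q z)) = sgn (n z - q z)"
      by (auto simp: sgn_if)
    moreover have "sgn ((- ln (w z) - (p + r * w z)) * (ln (n z) - ln (q z))) = - 1"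
      using chord[OF w that] unfolding eq by (rule sgn_neg)
    ultimately have "sgn (g z) = - 1" unfolding g_def sgn_mult by simp
    then show ?thesis by (simp add: sgn_if split: if_splits)
  qed
  have "has_bochner_integral lborel
      (\<lambda>z. (- ln (w z) * n z - (p * n z + r * (w z * n z))) - (- ln (w z) * q z - (p * q z + r * (w z * q z))))
      ((log_mean s - (p * 1 + r * (2 * x / (2 * x + 1)))) - (digamma_gap x - (p * 1 + r * (2 * x / (2 * x + 1)))))"
    by (intro has_bochner_integral_diff has_bochner_integral_add has_bochner_integral_mult_right
        n0 n1 n2 q0 q1 q2)
  also have "(\<lambda>z. (- ln (w z) * n z - (p * n z + r * (w z * n z))) - (- ln (w z) * q z - (p * q z + r * (w z * q z)))) = g"
    by (auto simp: g_def algebra_simps)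
  finally have gI: "has_bochner_integral lborel g (log_mean s - digamma_gap x)" by simp
  have finW: "finite {z. w z \<in> N}"
  proof (rule finite_subset)
    have "z \<in> (\<lambda>v. sqrt (2 * s * (1 / v - 1))) ` N \<union> (\<lambda>v. - sqrt (2 * s * (1 / v - 1))) ` N"
      if "w z \<in> N" for z
    proof -
      have "2 * s * (1 / w z - 1) = z\<^sup>2" using s by (simp add: w_def)
      then have "sqrt (2 * s * (1 / w z - 1)) = \<bar>z\<bar>" by simp
      then have "z = sqrt (2 * s * (1 / w z - 1)) \<or> z = - sqrt (2 * s * (1 / w z - 1))" by auto
      then show ?thesis using that by blast
    qed
    then show "{z. w z \<in> N} \<subseteq> (\<lambda>v. sqrt (2 * s * (1 / v - 1))) ` N \<union> (\<lambda>v. - sqrt (2 * s * (1 / v - 1))) ` N"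
      by blast
  qed (use N in simp)
  have ae: "AE z in lborel. w z \<notin> N"
    using AE_not_in[of "{z. w z \<in> N}" lborel] finite_imp_null_set_lborel[OF finW] by simp
  have "integral\<^sup>L lborel (\<lambda>z. - g z) \<ge> 0"
    by (rule integral_nonneg_AE) (use ae gneg in \<open>auto simp: less_imp_le elim: eventually_mono\<close>)
  moreover have "integral\<^sup>L lborel (\<lambda>z. - g z) \<noteq> 0"
  proof
    assume "integral\<^sup>L lborel (\<lambda>z. - g z) = 0"
    moreover have "integrable lborel (\<lambda>z. - g z)" using gI by (simp add: has_bochner_integral_iff)
    moreover have "AE z in lborel. 0 \<le> - g z"
      using ae gneg by (auto simp: less_imp_le elim: eventually_mono)
    ultimately have "AE z in lborel. - g z = 0"
      using integral_nonneg_eq_0_iff_AE[of lborel "\<lambda>z. - g z"] by blast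
    then have "AE z in std_normal. z \<in> {z. w z \<in> N}"
      unfolding std_normal_def using gneg by (subst AE_density) (auto elim!: eventually_mono, fastforce)
    then show False using std_normal_not_AE_finite[OF finW] by blast
  qed
  ultimately show ?thesis using gI unfolding x_def[symmetric] by (simp add: has_bochner_integral_iff)
qed

lemma digamma_gap_antimono:
  assumes "0 < x" "x \<le> y" shows "digamma_gap y \<le> digamma_gap x"
proof (rule DERIV_nonpos_imp_nonincreasing[OF assms(2)])
  fix u assume "x \<le> u" "u \<le> y"
  then have u: "u > 0" using assms by simp
  have "(digamma_gap has_real_derivative Polygamma 1 (u + 1 / 2) - Polygamma 1 u) (at u)"
    unfolding digamma_gap_def[abs_def] using u
    by (auto intro!: derivative_eq_intros elim!: nonpos_Ints_cases)
  moreover have "Polygamma 1 (u + 1 / 2) < Polygamma 1 u"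
    using u by (intro Polygamma_real_strict_antimono) auto
  ultimately show "\<exists>D. (digamma_gap has_real_derivative D) (at u) \<and> D \<le> 0"
    by (intro exI[of _ "Polygamma 1 (u + 1 / 2) - Polygamma 1 u"]) auto
qed

lemma digamma_gap_continuous: "x > 0 \<Longrightarrow> isCont digamma_gap x"
  unfolding digamma_gap_def[abs_def]
  by (intro continuous_intros) (auto elim!: nonpos_Ints_cases)

text \<open>The recursion of the digamma function gives \<open>digamma_gap x + digamma_gap (x - 1/2) = 1 / (x - 1/2)\<close>,
  and the first summand is the smaller one.\<close>

lemma digamma_gap_upper:
  assumes "x > 1 / 2" shows "digamma_gap x \<le> 1 / (2 * x - 1)"
proof -
  have "digamma_gap x + digamma_gap (x - 1 / 2) = 1 / (x - 1 / 2)"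
  proof -
    have "x - 1 / 2 + 1 = x + 1 / 2" by simp
    then have "Digamma (x + 1 / 2) = Digamma (x - 1 / 2) + 1 / (x - 1 / 2)"
      using Digamma_plus1[of "x - 1 / 2"] assms by (simp add: add.commute)
    then show ?thesis by (simp add: digamma_gap_def)
  qed
  moreover have "digamma_gap x \<le> digamma_gap (x - 1 / 2)"
    using assms by (intro digamma_gap_antimono) auto
  ultimately have "2 * digamma_gap x \<le> 1 / (x - 1 / 2)" by simp
  also have "\<dots> = 2 * (1 / (2 * x - 1))" using assms by (simp add: field_simps)
  finally show ?thesis by simp
qed

section \<open>Differential inequalities, the function A, and the right-hand sides\<close>

lemma first_zero:
  fixes f :: "real \<Rightarrow> real"
  assumes cont: "continuous_on {a..b} f" and "a \<le> b" and fa: "f a > 0" and fb: "f b \<le> 0"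
  obtains T where "a < T" "T \<le> b" "f T = 0" "\<And>t. a \<le> t \<Longrightarrow> t < T \<Longrightarrow> f t > 0"
proof -
  define Z where "Z = {t \<in> {a..b}. f t \<le> 0}"
  have "closed Z" unfolding Z_def
    using continuous_closed_preimage[OF cont, of "{..0}"] by (simp add: vimage_def Int_def conj_commute)
  moreover have "bounded Z" by (rule bounded_subset[of "{a..b}"]) (auto simp: Z_def)
  ultimately have "compact Z" by (simp add: compact_eq_bounded_closed)
  moreover have "b \<in> Z" using assms by (simp add: Z_def)
  ultimately obtain T where T: "T \<in> Z" "\<And>t. t \<in> Z \<Longrightarrow> T \<le> t"
    using compact_attains_inf[of Z] by blast
  have pos: "f t > 0" if "a \<le> t" "t < T" for t
    using T(2)[of t] T(1) that by (force simp: Z_def)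
  have aT: "a < T" using T(1) fa by (auto simp: Z_def order_le_less)
  have "\<exists>t\<ge>a. t \<le> T \<and> f t = 0"
    by (rule IVT2') (use T(1) fa aT in \<open>auto simp: Z_def intro: continuous_on_subset[OF cont]\<close>)
  then have "f T = 0" using pos by (metis less_irrefl order_le_less)
  then show thesis using that aT T(1) pos by (auto simp: Z_def)
qed

text \<open>Consider the first zero: there the function arrives from positive values, which a positive
  derivative forbids.\<close>

lemma barrier:
  fixes f :: "real \<Rightarrow> real"
  assumes cont: "continuous_on {a..b} f" and fa: "f a > 0"
    and up: "\<And>t. a < t \<Longrightarrow> t \<le> b \<Longrightarrow> f t = 0 \<Longrightarrow>
               \<exists>D>0. (f has_real_derivative D) (at t within {a..b})"
    and t: "a \<le> t" "t \<le> b"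
  shows "f t > 0"
proof (rule ccontr)
  assume "\<not> f t > 0"
  then obtain T where T: "a < T" "T \<le> t" "f T = 0" "\<And>u. a \<le> u \<Longrightarrow> u < T \<Longrightarrow> f u > 0"
    using first_zero[of a t f] continuous_on_subset[OF cont] fa t by (auto simp: not_less)
  then obtain D where "D > 0" "(f has_real_derivative D) (at T within {a..b})"
    using up t by (meson order_trans)
  then obtain d where d: "d > 0" "\<And>h. h > 0 \<Longrightarrow> T - h \<in> {a..b} \<Longrightarrow> h < d \<Longrightarrow> f (T - h) < f T"
    using has_real_derivative_pos_inc_left by blast
  define h where "h = min (d / 2) (T - a)"
  have "h > 0" "h < d" "T - h \<in> {a..b}" "a \<le> T - h" using d T t by (auto simp: h_def)
  then have "f (T - h) < 0" "f (T - h) > 0" using d(2)[of h] T(3) T(4)[of "T - h"] by auto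
  then show False by simp
qed

text \<open>While \<open>f \<le> 0\<close>, \<open>f\<close> gains at least as much as \<open>g\<close>, and \<open>g\<close> is unbounded, so \<open>f\<close> must become
  positive; afterwards it cannot return to 0. The clock \<open>g\<close> is either linear in \<open>t\<close> or, for rates
  that are not bounded below, the quantity that the motion itself drives to infinity.\<close>

lemma eventually_pos_if_driven:
  fixes f g :: "real \<Rightarrow> real"
  assumes g: "filterlim g at_top at_top"
    and D: "\<And>t. t \<ge> T \<Longrightarrow> \<exists>f' g'. (f has_real_derivative f') (at t) \<and> (g has_real_derivative g') (at t) \<and>
              (f t \<le> 0 \<longrightarrow> 0 < g' \<and> g' \<le> f')"
  shows "eventually (\<lambda>t. f t > 0) at_top"
proof -
  have cont: "continuous_on {a..b} f" if "T \<le> a" for a b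
  proof (rule continuous_at_imp_continuous_on, rule ballI)
    fix u assume "u \<in> {a..b}"
    then have "u \<ge> T" using that by simp
    from D[OF this] show "isCont f u" using DERIV_isCont by blast
  qed
  have "\<exists>t1\<ge>T. f t1 > 0"
  proof (rule ccontr)
    assume "\<not> (\<exists>t1\<ge>T. f t1 > 0)"
    then have neg: "f t \<le> 0" if "t \<ge> T" for t using that by force
    have "f T - g T \<le> f t - g t" if "t \<ge> T" for t
    proof (rule DERIV_nonneg_imp_nondecreasing[OF that])
      fix u assume "T \<le> u"
      then obtain f' g' where "(f has_real_derivative f') (at u)" "(g has_real_derivative g') (at u)" "g' \<le> f'"
        using D[of u] neg by blast
      then show "\<exists>d. ((\<lambda>t. f t - g t) has_real_derivative d) (at u) \<and> 0 \<le> d"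
        by (intro exI[of _ "f' - g'"]) (auto intro!: derivative_eq_intros)
    qed
    then have le: "g t \<le> g T - f T" if "t \<ge> T" for t using neg[OF that] that by fastforce
    have "eventually (\<lambda>t. g t > g T - f T \<and> t \<ge> T) at_top"
      using g by (intro eventually_conj) (auto simp: filterlim_at_top_dense eventually_ge_at_top)
    then obtain t where "g t > g T - f T" "t \<ge> T"
      using eventually_happens trivial_limit_at_top_linorder by blast
    with le[of t] show False by simp
  qed
  then obtain t1 where t1: "t1 \<ge> T" "f t1 > 0" by blast
  have "f t > 0" if "t \<ge> t1" for t
  proof (rule barrier[OF cont[OF t1(1)] t1(2)])
    fix u assume u: "t1 < u" "f u = 0"
    then obtain f' g' where "(f has_real_derivative f') (at u)" "0 < g'" "g' \<le> f'"
      using D[of u] t1(1) by auto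
    then show "\<exists>D>0. (f has_real_derivative D) (at u within {t1..t})"
      by (intro exI[of _ f']) (auto intro: has_field_derivative_at_within)
  qed (use that in auto)
  then show ?thesis by (auto simp: eventually_at_top_linorder)
qed

lemma mono_bounded_tendsto:
  fixes f :: "real \<Rightarrow> real"
  assumes mono: "\<And>t u. T \<le> t \<Longrightarrow> t \<le> u \<Longrightarrow> f t \<le> f u" and bd: "\<And>t. T \<le> t \<Longrightarrow> f t \<le> M"
  obtains l where "(f \<longlongrightarrow> l) at_top" "\<And>t. T \<le> t \<Longrightarrow> f t \<le> l" "l \<le> M"
proof -
  define l where "l = Sup (f ` {T..})"
  have bdd: "bdd_above (f ` {T..})" using bd by (auto intro!: bdd_aboveI2)
  have le: "f t \<le> l" if "T \<le> t" for t
    unfolding l_def using that bdd by (intro cSup_upper) auto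
  have lM: "l \<le> M" unfolding l_def using bd by (intro cSup_least) auto
  have "(f \<longlongrightarrow> l) at_top"
  proof (rule order_tendstoI)
    fix y assume "y < l"
    then obtain t where t: "T \<le> t" "y < f t"
      unfolding l_def using less_cSup_iff[OF _ bdd] by auto
    then have "y < f u" if "u \<ge> t" for u using mono[of t u] that by simp
    then show "eventually (\<lambda>u. y < f u) at_top" by (auto simp: eventually_at_top_linorder)
  next
    fix y assume "l < y"
    show "eventually (\<lambda>u. f u < y) at_top"
      using eventually_ge_at_top[of T]
    proof eventually_elim
      case (elim u)
      then show ?case using le[of u] \<open>l < y\<close> by simp
    qed
  qed
  then show thesis using that le lM by blast
qed

lemma F_deficit:
  assumes "x > 0" shows "F x = (1 - deficit x) / (2 * x)"
proof -
  have eq: "1 / (2 * x + z\<^sup>2) = 1 / (1 + z\<^sup>2 / (2 * x)) / (2 * x)" for z :: real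
  proof -
    have "(1 + z\<^sup>2 / (2 * x)) * (2 * x) = 2 * x + z\<^sup>2" using assms by (simp add: distrib_right)
    then show ?thesis by (simp only: divide_divide_eq_left)
  qed
  have "F x = (\<integral>z. 1 / (2 * x + z\<^sup>2) \<partial>std_normal)"
    unfolding F_def by (rule std_normal_integral_exp) simp
  also have "\<dots> = (\<integral>z. 1 / (1 + z\<^sup>2 / (2 * x)) / (2 * x) \<partial>std_normal)"
    by (simp only: eq)
  also have "\<dots> = (1 - deficit x) / (2 * x)"
    using weight_mean(2)[OF assms] by (simp only: integral_divide_zero)
  finally show ?thesis .
qed

lemma F_eq_iff_balance:
  assumes "x > 0" "a > 0"
  shows "F x = a / ((2 * a + 1) * x) \<longleftrightarrow> balance x = a"
proof -
  define d where "d = deficit x"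
  have d: "d > 0" using deficit_pos[OF assms(1)] by (simp add: d_def)
  have "F x = a / ((2 * a + 1) * x) \<longleftrightarrow> (1 - d) * (2 * a + 1) = 2 * a"
  proof -
    have "a / ((2 * a + 1) * x) = 2 * a / (2 * a + 1) / (2 * x)" by simp
    moreover have "F x = (1 - d) / (2 * x)" unfolding d_def by (rule F_deficit[OF assms(1)])
    ultimately have "F x = a / ((2 * a + 1) * x) \<longleftrightarrow> (1 - d) / (2 * x) = 2 * a / (2 * a + 1) / (2 * x)"
      by (simp only:)
    also have "\<dots> \<longleftrightarrow> 1 - d = 2 * a / (2 * a + 1)"
      unfolding divide_cancel_right using assms(1) by simp
    also have "\<dots> \<longleftrightarrow> (1 - d) * (2 * a + 1) = 2 * a"
      using assms(2) by (intro nonzero_eq_divide_eq) simp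
    finally show ?thesis .
  qed
  also have "\<dots> \<longleftrightarrow> (1 / d - 1) / 2 = a"
    using d by (simp add: field_simps)
  finally show ?thesis by (simp add: balance_def d_def)
qed

text \<open>Since \<open>2 x F(x) = 1 - deficit x\<close>, the equation that defines \<open>A\<close> is an equation for \<open>balance\<close>, and
  strict monotonicity of \<open>balance\<close> gives uniqueness.\<close>

lemma A_balance:
  assumes "y > 0" shows "A (balance y) = balance y - y"
  unfolding A_def
proof (rule the_equality)
  have b: "balance y > 0" by (rule balance_pos[OF assms])
  then show "balance y - y < balance y \<and>
      F (balance y - (balance y - y)) = balance y / ((2 * balance y + 1) * (balance y - (balance y - y)))"
    using assms F_eq_iff_balance[OF assms b] by simp
  fix a assume a: "a < balance y \<and> F (balance y - a) = balance y / ((2 * balance y + 1) * (balance y - a))"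
  then have "balance (balance y - a) = balance y"
    using F_eq_iff_balance[of "balance y - a" "balance y"] b by simp
  then have "balance y - a = y"
    using balance_strict_mono[of "balance y - a" y] balance_strict_mono[of y "balance y - a"] a assms
    by (cases "balance y - a" y rule: linorder_cases) auto
  then show "a = balance y - y" by simp
qed

lemma E_dK_closed_form:
  assumes "V > 0" "b > 0" "n > 0"
  defines "s \<equiv> \<sigma> b n / V"
  shows "s > 0"
    and "E_dK_d\<alpha> V a b n = log_mean s - digamma_gap a"
    and "E_dK_d\<beta> V a b n = deficit s * (balance s - a) / b"
    and "E_dK_d\<nu> V a b n = deficit s * (a - balance s) / (n * (n + 1))"
proof -
  have sig: "\<sigma> b n > 0" using assms by (simp add: \<sigma>_def)
  then show s: "s > 0" using assms by (simp add: s_def)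
  have q: "V / \<sigma> b n * (z\<^sup>2 / 2) = z\<^sup>2 / (2 * s)" for z
    using sig assms(1) by (simp add: s_def mult.commute)
  have bal: "deficit s * balance s = (1 - deficit s) / 2"
    using deficit_balance[OF s] by (simp add: algebra_simps)
  have scale: "c / sqrt (2 * pi) * I = c * (1 / sqrt (2 * pi) * I)" for c I :: real by simp
  have "1 / sqrt (2 * pi) * (\<integral>z. ln (1 + z\<^sup>2 / (2 * s)) * exp (- z\<^sup>2 / 2) \<partial>lborel) = log_mean s"
    unfolding log_mean_def by (rule std_normal_integral_exp) measurable
  then show "E_dK_d\<alpha> V a b n = log_mean s - digamma_gap a"
    unfolding E_dK_d\<alpha>_def q digamma_gap_def by simp
  have "1 / sqrt (2 * pi) * (\<integral>z. 1 / (1 + z\<^sup>2 / (2 * s)) * exp (- z\<^sup>2 / 2) \<partial>lborel) = 1 - deficit s"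
    unfolding weight_mean(2)[OF s, symmetric] by (rule std_normal_integral_exp) measurable
  then have "(a + 1 / 2) / sqrt (2 * pi) * (\<integral>z. 1 / (1 + z\<^sup>2 / (2 * s)) * exp (- z\<^sup>2 / 2) \<partial>lborel) - a
      = (a + 1 / 2) * (1 - deficit s) - a"
    by (subst scale) (simp only:)
  also have "\<dots> = deficit s * (balance s - a)"
    using bal by (simp add: algebra_simps)
  finally show "E_dK_d\<beta> V a b n = deficit s * (balance s - a) / b"
    unfolding E_dK_d\<beta>_def q by simp
  have q2: "2 * \<sigma> b n / V = 2 * s" by (simp add: s_def)
  have "1 / sqrt (2 * pi) * (\<integral>z. z\<^sup>2 / (2 * s + z\<^sup>2) * exp (- z\<^sup>2 / 2) \<partial>lborel) = deficit s"
    unfolding deficit_def by (rule std_normal_integral_exp) measurable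
  then have "(2 * a + 1) / sqrt (2 * pi) * (\<integral>z. z\<^sup>2 / (2 * s + z\<^sup>2) * exp (- z\<^sup>2 / 2) \<partial>lborel) - 1
      = (2 * a + 1) * deficit s - 1"
    by (subst scale) (simp only:)
  also have "\<dots> = 2 * (deficit s * (a - balance s))"
    using bal by (simp add: algebra_simps)
  finally show "E_dK_d\<nu> V a b n = deficit s * (a - balance s) / (n * (n + 1))"
    unfolding E_dK_d\<nu>_def q2 using assms by simp
qed

section \<open>The gradient flow\<close>

locale gradient_flow =
  fixes V :: real and \<alpha> \<beta> \<nu> :: "real \<Rightarrow> real"
  assumes V: "V > 0"
    and init: "\<alpha> 0 > 0" "\<beta> 0 > 0" "\<nu> 0 > 0"
    and flow_\<alpha>: "\<And>t. t \<ge> 0 \<Longrightarrow>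
      (\<alpha> has_real_derivative - E_dK_d\<alpha> V (\<alpha> t) (\<beta> t) (\<nu> t)) (at t within {0..})"
    and flow_\<beta>: "\<And>t. t \<ge> 0 \<Longrightarrow>
      (\<beta> has_real_derivative - E_dK_d\<beta> V (\<alpha> t) (\<beta> t) (\<nu> t)) (at t within {0..})"
    and flow_\<nu>: "\<And>t. t \<ge> 0 \<Longrightarrow>
      (\<nu> has_real_derivative - E_dK_d\<nu> V (\<alpha> t) (\<beta> t) (\<nu> t)) (at t within {0..})"
begin

definition s :: "real \<Rightarrow> real" where
  "s t = \<sigma> (\<beta> t) (\<nu> t) / V"

text \<open>Positive exactly if \<open>s\<close> is smaller than the point \<open>\<alpha> - A(\<alpha>)\<close>.\<close>

definition gap :: "real \<Rightarrow> real" where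
  "gap t = \<alpha> t - balance (s t)"

definition positive :: "real \<Rightarrow> bool" where
  "positive t \<longleftrightarrow> \<alpha> t > 0 \<and> \<beta> t > 0 \<and> \<nu> t > 0"

definition speed :: "real \<Rightarrow> real" where
  "speed t = ((\<nu> t + 1) / (\<beta> t * \<nu> t) + \<beta> t / (\<nu> t ^ 3 * (\<nu> t + 1))) / V * deficit (s t)"

lemma s_pos: "positive t \<Longrightarrow> s t > 0"
  using V by (simp add: positive_def s_def \<sigma>_def)

lemma speed_pos: "positive t \<Longrightarrow> speed t > 0"
  using V deficit_pos[OF s_pos[of t]]
  by (simp add: positive_def speed_def add_pos_pos)

lemma derivative_\<alpha>:
  assumes "t \<ge> 0" "positive t"
  shows "(\<alpha> has_real_derivative digamma_gap (\<alpha> t) - log_mean (s t)) (at t within {0..})"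
  using flow_\<alpha>[OF assms(1)] assms(2) V by (simp add: E_dK_closed_form positive_def s_def)

lemma derivative_\<beta>:
  assumes "t \<ge> 0" "positive t"
  shows "(\<beta> has_real_derivative deficit (s t) * gap t / \<beta> t) (at t within {0..})"
proof -
  have "- E_dK_d\<beta> V (\<alpha> t) (\<beta> t) (\<nu> t) = deficit (s t) * gap t / \<beta> t"
    using assms(2) V by (simp add: E_dK_closed_form positive_def s_def gap_def
        minus_divide_left right_diff_distrib)
  then show ?thesis using flow_\<beta>[OF assms(1)] by simp
qed

lemma derivative_\<nu>:
  assumes "t \<ge> 0" "positive t"
  shows "(\<nu> has_real_derivative - (deficit (s t) * gap t / (\<nu> t * (\<nu> t + 1)))) (at t within {0..})"
  using flow_\<nu>[OF assms(1)] assms(2) V by (simp add: E_dK_closed_form positive_def s_def gap_def)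

text \<open>Both \<open>\<beta>'\<close> and \<open>\<nu>'\<close> are multiples of \<open>deficit s * gap\<close>, with opposite signs, and \<open>\<sigma>\<close> increases in
  \<open>\<beta>\<close> and decreases in \<open>\<nu>\<close>; the contributions add up to the factor \<open>speed\<close>.\<close>

lemma derivative_s:
  assumes "t \<ge> 0" "positive t"
  shows "(s has_real_derivative speed t * gap t) (at t within {0..})"
proof -
  have pos: "\<beta> t > 0" "\<nu> t > 0" using assms by (auto simp: positive_def)
  define q where "q = deficit (s t) * gap t"
  define r where "r = - (q / (\<nu> t * (\<nu> t + 1)))"
  have d\<beta>: "(\<beta> has_real_derivative q / \<beta> t) (at t within {0..})"
    and d\<nu>: "(\<nu> has_real_derivative r) (at t within {0..})"
    using derivative_\<beta>[OF assms] derivative_\<nu>[OF assms] by (simp_all add: q_def r_def)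
  have "((\<lambda>t. \<beta> t * (\<nu> t + 1) / \<nu> t / V) has_real_derivative
      ((q / \<beta> t * (\<nu> t + 1) + (r + 0) * \<beta> t) * \<nu> t - \<beta> t * (\<nu> t + 1) * r) / (\<nu> t * \<nu> t) / V)
        (at t within {0..})"
    using pos by (intro DERIV_cdivide DERIV_divide DERIV_mult DERIV_add DERIV_const d\<beta> d\<nu>) auto
  moreover have "((q / b * (n + 1) + (- (q / (n * (n + 1))) + 0) * b) * n
        - b * (n + 1) * (- (q / (n * (n + 1))))) / (n * n)
      = ((n + 1) / (b * n) + b / (n ^ 3 * (n + 1))) * q" if "b > 0" "n > 0" for b n
  proof -
    have "n + 1 \<noteq> 0" using that by simp
    then show ?thesis using that by (simp add: divide_simps) (simp add: algebra_simps power3_eq_cube)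
  qed
  from this[OF pos] have "((q / \<beta> t * (\<nu> t + 1) + (r + 0) * \<beta> t) * \<nu> t - \<beta> t * (\<nu> t + 1) * r)
      / (\<nu> t * \<nu> t) / V = speed t * gap t"
    unfolding r_def[symmetric] by (simp add: speed_def q_def)
  ultimately show ?thesis by (simp add: s_def[abs_def] \<sigma>_def)
qed

text \<open>The factor \<open>D\<close> is the slope of \<open>balance\<close> at \<open>s t\<close>. Sharing it between the two derivatives is what
  allows them to be compared.\<close>

lemma derivative_balance_s:
  assumes "t \<ge> 0" "positive t"
  obtains D where "D \<ge> 1"
    "((\<lambda>t. balance (s t)) has_real_derivative D * (speed t * gap t)) (at t within {0..})"
    "(gap has_real_derivative digamma_gap (\<alpha> t) - log_mean (s t) - D * (speed t * gap t)) (at t within {0..})"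
proof -
  obtain D where D: "(balance has_real_derivative D) (at (s t))" "D \<ge> 1"
    using balance_derivative[OF s_pos[OF assms(2)]] by blast
  have 1: "((\<lambda>t. balance (s t)) has_real_derivative D * (speed t * gap t)) (at t within {0..})"
    using DERIV_chain2[OF D(1) derivative_s[OF assms]] .
  have "(gap has_real_derivative digamma_gap (\<alpha> t) - log_mean (s t) - D * (speed t * gap t)) (at t within {0..})"
    unfolding gap_def[abs_def] using DERIV_diff[OF derivative_\<alpha>[OF assms] 1] by (simp add: gap_def)
  then show thesis using that D(2) 1 by blast
qed

lemma at_within_nonneg: "t > (0::real) \<Longrightarrow> at t within {0..} = at t"
  by (rule at_within_interior) simp

lemma continuous_params:
  assumes "0 \<le> a"
  shows "continuous_on {a..b} \<alpha>" "continuous_on {a..b} \<beta>" "continuous_on {a..b} \<nu>"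
proof -
  have "continuous_on {0..} \<alpha>" "continuous_on {0..} \<beta>" "continuous_on {0..} \<nu>"
    by (rule DERIV_continuous_on, rule flow_\<alpha> flow_\<beta> flow_\<nu>, simp)+
  then show "continuous_on {a..b} \<alpha>" "continuous_on {a..b} \<beta>" "continuous_on {a..b} \<nu>"
    using assms by (auto intro: continuous_on_subset)
qed

lemma continuous_of_derivative:
  assumes "0 \<le> a" "\<And>t. a \<le> t \<Longrightarrow> t \<le> b \<Longrightarrow> \<exists>D. (f has_real_derivative D) (at t within {0..})"
  shows "continuous_on {a..b} f"
  unfolding continuous_on_eq_continuous_within
proof
  fix t assume "t \<in> {a..b}"
  then obtain D where "(f has_real_derivative D) (at t within {0..})" using assms by auto
  then have "(f has_real_derivative D) (at t within {a..b})"
    by (rule has_field_derivative_subset) (use assms in auto)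
  then show "continuous (at t within {a..b}) f" by (rule DERIV_continuous)
qed

lemma monotone_of_derivative:
  assumes "0 \<le> a" "a \<le> b"
    and D: "\<And>t. a \<le> t \<Longrightarrow> t \<le> b \<Longrightarrow> \<exists>D\<ge>0. (f has_real_derivative D) (at t within {0..})"
  shows "f a \<le> f b"
proof (rule DERIV_nonneg_imp_increasing_open[OF assms(2)])
  fix t assume "a < t" "t < b"
  then show "\<exists>y. DERIV f t :> y \<and> 0 \<le> y"
    using D[of t] at_within_nonneg[of t] assms(1) by auto
next
  show "continuous_on {a..b} f" using continuous_of_derivative[OF assms(1)] D by blast
qed

text \<open>On the curve \<open>gap = 0\<close> the variable \<open>s\<close> rests and \<open>\<alpha> = balance s\<close>, so the derivative of the gap is
  \<open>digamma_gap (balance s) - log_mean s > 0\<close>.\<close>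

lemma gap_stays_positive:
  assumes "0 \<le> a" "a \<le> b" "gap a > 0" and pos: "\<And>t. a \<le> t \<Longrightarrow> t \<le> b \<Longrightarrow> positive t"
  shows "gap b > 0"
proof (rule barrier[of a b gap])
  show "continuous_on {a..b} gap"
    using assms(1) by (rule continuous_of_derivative)
      (use pos assms(1) derivative_balance_s in \<open>meson order_trans\<close>)
  fix t assume t: "a < t" "t \<le> b" "gap t = 0"
  then have t0: "t \<ge> 0" "positive t" using assms(1) pos[of t] by auto
  obtain D where "(gap has_real_derivative digamma_gap (\<alpha> t) - log_mean (s t) - D * (speed t * gap t)) (at t within {0..})"
    using derivative_balance_s[OF t0] by blast
  then have "(gap has_real_derivative digamma_gap (\<alpha> t) - log_mean (s t)) (at t within {a..b})"
    using t(3) assms(1) by (auto intro: has_field_derivative_subset)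
  moreover have "\<alpha> t = balance (s t)" using t(3) by (simp add: gap_def)
  then have "digamma_gap (\<alpha> t) - log_mean (s t) > 0"
    using log_mean_less_digamma_gap[OF s_pos[OF t0(2)]] by simp
  ultimately show "\<exists>D>0. (gap has_real_derivative D) (at t within {a..b})" by blast
qed (use assms in auto)

lemma gap_pos_monotone:
  assumes "0 \<le> a" "a \<le> b" and "\<And>t. a \<le> t \<Longrightarrow> t \<le> b \<Longrightarrow> positive t \<and> gap t > 0"
  shows "s a \<le> s b" "\<beta> a \<le> \<beta> b"
proof -
  have nn: "t \<ge> 0 \<and> positive t \<and> gap t > 0 \<and> \<beta> t > 0 \<and> deficit (s t) > 0 \<and> speed t > 0" if "a \<le> t" "t \<le> b" for t
    using assms(3)[OF that] assms(1) that deficit_pos[OF s_pos[of t]] speed_pos[of t] by (auto simp: positive_def)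
  show "s a \<le> s b"
    using assms(1,2) by (rule monotone_of_derivative)
      (use nn derivative_s in \<open>meson less_imp_le mult_nonneg_nonneg\<close>)
  show "\<beta> a \<le> \<beta> b"
    using assms(1,2) by (rule monotone_of_derivative)
      (use nn derivative_\<beta> in \<open>meson less_imp_le mult_nonneg_nonneg divide_nonneg_nonneg\<close>)
qed

text \<open>For \<open>\<alpha>\<close>: here \<open>\<alpha> \<le> balance s\<close>, and \<open>digamma_gap\<close> is decreasing.\<close>

lemma gap_nonpos_monotone:
  assumes "0 \<le> a" "a \<le> b" and "\<And>t. a \<le> t \<Longrightarrow> t \<le> b \<Longrightarrow> positive t \<and> gap t \<le> 0"
  shows "s b \<le> s a" "\<alpha> a \<le> \<alpha> b" "\<nu> a \<le> \<nu> b"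
proof -
  have nn: "t \<ge> 0" "positive t" "gap t \<le> 0" "\<nu> t > 0" "deficit (s t) > 0" "speed t > 0" "s t > 0" "\<alpha> t > 0"
    if "a \<le> t" "t \<le> b" for t
    using assms(3)[OF that] assms(1) that deficit_pos[OF s_pos[of t]] speed_pos[of t] s_pos[of t]
    by (auto simp: positive_def)
  have "- s a \<le> - s b"
  proof (rule monotone_of_derivative[OF assms(1,2)])
    fix t assume t: "a \<le> t" "t \<le> b"
    show "\<exists>D\<ge>0. ((\<lambda>t. - s t) has_real_derivative D) (at t within {0..})"
      using DERIV_minus[OF derivative_s[OF nn(1,2)[OF t]]] nn[OF t]
      by (intro exI[of _ "- (speed t * gap t)"]) (auto simp: mult_nonneg_nonpos)
  qed
  then show "s b \<le> s a" by simp
  show "\<alpha> a \<le> \<alpha> b"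
  proof (rule monotone_of_derivative[OF assms(1,2)])
    fix t assume t: "a \<le> t" "t \<le> b"
    have "\<alpha> t \<le> balance (s t)" using nn(3)[OF t] by (simp add: gap_def)
    then have "digamma_gap (balance (s t)) \<le> digamma_gap (\<alpha> t)"
      using nn[OF t] by (intro digamma_gap_antimono)
    then have "0 \<le> digamma_gap (\<alpha> t) - log_mean (s t)"
      using log_mean_less_digamma_gap[OF nn(7)[OF t]] by simp
    then show "\<exists>D\<ge>0. (\<alpha> has_real_derivative D) (at t within {0..})"
      using derivative_\<alpha>[OF nn(1,2)[OF t]] by blast
  qed
  show "\<nu> a \<le> \<nu> b"
  proof (rule monotone_of_derivative[OF assms(1,2)])
    fix t assume t: "a \<le> t" "t \<le> b"
    have "deficit (s t) * gap t \<le> 0" using nn[OF t] by (simp add: mult_nonneg_nonpos)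
    then have "0 \<le> - (deficit (s t) * gap t / (\<nu> t * (\<nu> t + 1)))"
      using nn(4)[OF t] by (simp add: divide_nonpos_pos)
    then show "\<exists>D\<ge>0. (\<nu> has_real_derivative D) (at t within {0..})"
      using derivative_\<nu>[OF nn(1,2)[OF t]] by blast
  qed
qed

lemma s_mult_\<nu>: "positive t \<Longrightarrow> s t * V * \<nu> t = \<beta> t * (\<nu> t + 1)"
  using V by (simp add: s_def \<sigma>_def positive_def)

text \<open>Suppose that \<open>T\<close> is the first time at which one of the parameters vanishes. It suffices to bound all
  of them below by a positive constant shortly before \<open>T\<close>. If the gap becomes positive before \<open>T\<close>, then
  from there on \<open>\<beta>\<close> and \<open>s\<close> increase, \<open>\<alpha> > balance s\<close>, and a small \<open>\<nu>\<close> would make \<open>s\<close> large, while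
  \<open>s \<le> balance s < \<alpha>\<close> is bounded. Otherwise \<open>\<alpha>\<close> and \<open>\<nu>\<close> increase, and \<open>balance s \<ge> \<alpha>\<close> keeps \<open>s\<close>, and with
  it \<open>\<beta>\<close>, away from 0.\<close>

lemma always_positive:
  assumes "t \<ge> 0" shows "positive t"
proof (rule ccontr)
  define f where "f = (\<lambda>t. min (\<alpha> t) (min (\<beta> t) (\<nu> t)))"
  have pos_iff: "positive t \<longleftrightarrow> f t > 0" for t by (auto simp: positive_def f_def)
  have fcont: "continuous_on {0..b} f" for b
    unfolding f_def using continuous_params[of 0 b] by (intro continuous_intros) auto
  assume "\<not> positive t"
  then have "f t \<le> 0" using pos_iff[of t] by simp
  moreover have "f 0 > 0" using init by (simp add: f_def)
  ultimately obtain T where T: "0 < T" "f T = 0" and "\<And>u. 0 \<le> u \<Longrightarrow> u < T \<Longrightarrow> f u > 0"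
    using first_zero[OF fcont assms] by metis
  then have before: "\<And>u. 0 \<le> u \<Longrightarrow> u < T \<Longrightarrow> positive u" using pos_iff by blast
  have bounded_below: False if "c > 0" "0 \<le> a" "a < T" "\<And>u. a \<le> u \<Longrightarrow> u < T \<Longrightarrow> f u \<ge> c" for a c
  proof -
    have "continuous (at T within {0..T}) f"
      using fcont[of T] T(1) by (auto simp: continuous_on_eq_continuous_within)
    then have "(f \<longlongrightarrow> f T) (at T within {0..T})" by (simp add: continuous_within)
    then have "(f \<longlongrightarrow> f T) (at_left T)"
      using T(1) by (metis at_within_Icc_at_left)
    moreover have "eventually (\<lambda>u. c \<le> f u) (at_left T)"
      using that by (intro eventually_at_leftI[of a]) auto
    ultimately have "c \<le> f T" by (intro tendsto_lowerbound) auto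
    then show False using T(2) that(1) by simp
  qed
  show False
  proof (cases "\<exists>a. 0 \<le> a \<and> a < T \<and> gap a > 0")
    case True
    then obtain a where a: "0 \<le> a" "a < T" "gap a > 0" by blast
    have g: "gap u > 0" if "a \<le> u" "u < T" for u
      using gap_stays_positive[of a u] a that before by auto
    obtain M where M: "\<And>u. u \<in> {0..T} \<Longrightarrow> \<alpha> u \<le> M"
      using continuous_attains_sup[OF compact_Icc _ continuous_params(1)[of 0 T]] T(1) by fastforce
    have M0: "M > 0" using M[of 0] T(1) init by auto
    define c where "c = min (balance (s a)) (min (\<beta> a) (\<beta> a / (M * V)))"
    have pa: "positive a" using before a by simp
    have c: "c > 0" using balance_pos[OF s_pos[OF pa]] pa M0 V by (auto simp: c_def positive_def)
    have "f u \<ge> c" if u: "a \<le> u" "u < T" for u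
    proof -
      have pu: "positive u" using before a u by simp
      have mono: "s a \<le> s u" "\<beta> a \<le> \<beta> u"
        using gap_pos_monotone[of a u] a u g before by auto
      have gu: "balance (s u) < \<alpha> u" using g[OF u] by (simp add: gap_def)
      have "balance (s a) \<le> balance (s u)"
        using balance_diff_ge[OF s_pos[OF pa] mono(1)] mono(1) by simp
      then have 1: "balance (s a) \<le> \<alpha> u" using gu by simp
      have "s u \<le> M" using balance_ge[OF s_pos[OF pu]] gu M[of u] u a by simp
      then have "s u * V * \<nu> u \<le> M * V * \<nu> u"
        using V pu by (intro mult_right_mono) (auto simp: positive_def)
      moreover have "\<beta> a \<le> \<beta> u * (\<nu> u + 1)"
        using mono(2) pu by (simp add: positive_def distrib_left add_increasing)
      ultimately have "\<beta> a \<le> M * V * \<nu> u" using s_mult_\<nu>[OF pu] by simp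
      then have 2: "\<beta> a / (M * V) \<le> \<nu> u" using M0 V by (simp add: pos_divide_le_eq mult_ac)
      show ?thesis using 1 2 mono(2) by (auto simp: f_def c_def)
    qed
    then show False using bounded_below[OF c a(1,2)] by blast
  next
    case False
    then have g: "gap u \<le> 0" if "0 \<le> u" "u < T" for u using that by force
    obtain c0 where c0: "c0 > 0" "\<And>s. s > 0 \<Longrightarrow> \<alpha> 0 \<le> balance s \<Longrightarrow> c0 \<le> s"
      using balance_small[OF init(1)] by blast
    define c where "c = min (\<alpha> 0) (min (c0 * V * (\<nu> 0 / (\<nu> 0 + 1))) (\<nu> 0))"
    have c: "c > 0" using init c0 V by (simp add: c_def)
    have "f u \<ge> c" if u: "0 \<le> u" "u < T" for u
    proof -
      have pu: "positive u" using before u by simp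
      have mono: "\<alpha> 0 \<le> \<alpha> u" "\<nu> 0 \<le> \<nu> u"
        using gap_nonpos_monotone[of 0 u] u g before by auto
      have "\<alpha> 0 \<le> balance (s u)" using g[OF u] mono(1) by (simp add: gap_def)
      then have "c0 \<le> s u" using c0(2) s_pos[OF pu] by blast
      moreover have "\<nu> 0 / (\<nu> 0 + 1) \<le> \<nu> u / (\<nu> u + 1)"
        using mono(2) init by (simp add: divide_simps) (simp add: algebra_simps)
      ultimately have "c0 * V * (\<nu> 0 / (\<nu> 0 + 1)) \<le> s u * V * (\<nu> u / (\<nu> u + 1))"
        using V init c0(1) by (intro mult_mono) auto
      also have "\<dots> = \<beta> u"
        using s_mult_\<nu>[OF pu] pu by (simp add: positive_def field_simps)
      finally show ?thesis using mono by (auto simp: f_def c_def)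
    qed
    then show False using bounded_below[OF c, of 0] T(1) by blast
  qed
qed

text \<open>The quantity \<open>\<Phi>\<close> below is conserved because \<open>\<beta> \<beta>' = - \<nu> (\<nu> + 1) \<nu>'\<close>. It bounds \<open>\<beta>\<close>, and the first
  summand in \<open>speed\<close> exceeds \<open>1 / \<beta>\<close>.\<close>

lemma speed_lower:
  obtains k where "k > 0" "\<And>t. t \<ge> 0 \<Longrightarrow> k * deficit (s t) \<le> speed t"
proof -
  define \<Phi> where "\<Phi> = (\<lambda>t. \<beta> t ^ 2 / 2 + \<nu> t ^ 2 / 2 + \<nu> t ^ 3 / 3)"
  have d\<Phi>: "(\<Phi> has_real_derivative 0) (at t within {0..})" if "t \<ge> 0" for t
  proof -
    have pos: "\<beta> t > 0" "\<nu> t > 0" using always_positive[OF that] by (auto simp: positive_def)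
    define q where "q = deficit (s t) * gap t"
    define b' n' where "b' = q / \<beta> t" and "n' = - (q / (\<nu> t * (\<nu> t + 1)))"
    have "(\<beta> has_real_derivative b') (at t within {0..})" "(\<nu> has_real_derivative n') (at t within {0..})"
      using derivative_\<beta>[OF that always_positive[OF that]] derivative_\<nu>[OF that always_positive[OF that]]
      by (simp_all add: b'_def n'_def q_def)
    then have "(\<Phi> has_real_derivative \<beta> t * b' + (\<nu> t + \<nu> t ^ 2) * n') (at t within {0..})"
      unfolding \<Phi>_def by (auto intro!: derivative_eq_intros simp: algebra_simps power2_eq_square)
    moreover have "\<nu> t + \<nu> t ^ 2 = \<nu> t * (\<nu> t + 1)" by (simp add: power2_eq_square algebra_simps)
    moreover have "\<beta> t * b' = q" "\<nu> t * (\<nu> t + 1) * n' = - q"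
      using pos by (simp_all add: b'_def n'_def add_pos_pos less_imp_neq[symmetric])
    ultimately show ?thesis by simp
  qed
  define B where "B = sqrt (2 * \<Phi> 0)"
  have "\<Phi> 0 > 0" using init by (simp add: \<Phi>_def add_pos_pos)
  then have B: "B > 0" by (simp add: B_def)
  have \<beta>_le: "\<beta> t \<le> B" if "t \<ge> 0" for t
  proof -
    have "- \<Phi> 0 \<le> - \<Phi> t"
      by (rule monotone_of_derivative[OF order_refl that, of "\<lambda>t. - \<Phi> t"]) (use DERIV_minus[OF d\<Phi>] in force)
    moreover have "\<nu> t > 0" using always_positive[OF that] by (simp add: positive_def)
    then have "\<nu> t ^ 2 / 2 + \<nu> t ^ 3 / 3 \<ge> 0" by simp
    ultimately have "\<beta> t ^ 2 / 2 \<le> \<Phi> 0" unfolding \<Phi>_def by linarith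
    then show ?thesis unfolding B_def by (intro real_le_rsqrt) simp
  qed
  show thesis
  proof (rule that[of "1 / (B * V)"])
    fix t :: real assume t: "t \<ge> 0"
    have pos: "\<beta> t > 0" "\<nu> t > 0" using always_positive[OF t] by (auto simp: positive_def)
    have "1 / B \<le> 1 / \<beta> t" using \<beta>_le[OF t] pos by (intro divide_left_mono) auto
    also have "1 / \<beta> t \<le> (\<nu> t + 1) / (\<beta> t * \<nu> t)" using pos by (simp add: divide_simps)
    also have "\<dots> \<le> (\<nu> t + 1) / (\<beta> t * \<nu> t) + \<beta> t / (\<nu> t ^ 3 * (\<nu> t + 1))"
      using pos by simp
    finally have "1 / B / V * deficit (s t) \<le> speed t"
      unfolding speed_def using V deficit_pos[OF s_pos[OF always_positive[OF t]]]
      by (intro mult_right_mono divide_right_mono) auto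
    then show "1 / (B * V) * deficit (s t) \<le> speed t" by simp
  qed (use B V in simp)
qed

text \<open>By \<open>log_mean_less_digamma_gap\<close> and continuity there is \<open>x > balance l\<close> with \<open>digamma_gap x > log_mean l\<close>.
  As long as \<open>\<alpha> \<le> x\<close>, the derivative of \<open>\<alpha>\<close> is eventually at least a positive constant, so \<open>\<alpha>\<close> ends up
  above \<open>x\<close> while \<open>balance s\<close> approaches \<open>balance l\<close>.\<close>

lemma gap_eventually_bounded_below:
  assumes lim: "(s \<longlongrightarrow> l) at_top" and l: "l > 0"
  obtains d where "d > 0" "eventually (\<lambda>t. gap t \<ge> d) at_top"
proof -
  define b where "b = balance l"
  have b: "b > 0" "digamma_gap b > log_mean l"
    using balance_pos[OF l] log_mean_less_digamma_gap[OF l] by (auto simp: b_def)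
  have "eventually (\<lambda>x. digamma_gap x > log_mean l) (at_right b)"
    using digamma_gap_continuous[OF b(1)] b(2)
    by (auto simp: isCont_def intro!: order_tendstoD(1) elim: tendsto_within_subset)
  moreover have "eventually (\<lambda>x. x > b) (at_right b)" by (simp add: eventually_at_right_less)
  ultimately have "eventually (\<lambda>x. digamma_gap x > log_mean l \<and> x > b) (at_right b)"
    by (rule eventually_conj)
  then obtain x where x: "digamma_gap x > log_mean l" "x > b"
    using eventually_happens trivial_limit_at_right_real by blast
  define c where "c = (digamma_gap x - log_mean l) / 2"
  have c: "c > 0" "log_mean l < digamma_gap x - c" using x by (auto simp: c_def field_simps)
  have "((\<lambda>t. log_mean (s t)) \<longlongrightarrow> log_mean l) at_top"
    by (rule isCont_tendsto_compose[OF log_mean_continuous[OF l] lim])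
  then have "eventually (\<lambda>t. log_mean (s t) < digamma_gap x - c) at_top"
    using c(2) by (rule order_tendstoD)
  then obtain T where T: "\<And>t. t \<ge> T \<Longrightarrow> log_mean (s t) < digamma_gap x - c"
    by (auto simp: eventually_at_top_linorder)
  have "eventually (\<lambda>t. \<alpha> t - x > 0) at_top"
  proof (rule eventually_pos_if_driven[where g = "\<lambda>t. c * t" and T = "max T 1"])
    show "filterlim (\<lambda>t. c * t) at_top at_top" using c(1) by real_asymp
    fix t assume t: "t \<ge> max T 1"
    have p: "positive t" using always_positive t by simp
    have "(\<alpha> has_real_derivative digamma_gap (\<alpha> t) - log_mean (s t)) (at t)"
      using derivative_\<alpha>[of t] at_within_nonneg[of t] p t by simp
    moreover have "c \<le> digamma_gap (\<alpha> t) - log_mean (s t)" if "\<alpha> t \<le> x"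
      using digamma_gap_antimono[of "\<alpha> t" x] that p T[of t] t by (simp add: positive_def)
    ultimately show "\<exists>f' g'. ((\<lambda>t. \<alpha> t - x) has_real_derivative f') (at t) \<and>
        ((\<lambda>t. c * t) has_real_derivative g') (at t) \<and> (\<alpha> t - x \<le> 0 \<longrightarrow> 0 < g' \<and> g' \<le> f')"
      using c(1) by (intro exI[of _ "digamma_gap (\<alpha> t) - log_mean (s t)"] exI[of _ c])
        (auto intro!: derivative_eq_intros)
  qed
  moreover have "eventually (\<lambda>t. balance (s t) < (b + x) / 2) at_top"
  proof (rule order_tendstoD)
    show "((\<lambda>t. balance (s t)) \<longlongrightarrow> b) at_top"
      unfolding b_def by (rule isCont_tendsto_compose[OF balance_continuous[OF l] lim])
  qed (use x in simp)
  ultimately have "eventually (\<lambda>t. gap t \<ge> (x - b) / 2) at_top"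
    by eventually_elim (simp add: gap_def field_simps)
  then show thesis using that[of "(x - b) / 2"] x by simp
qed

text \<open>Otherwise \<open>s\<close> would decrease to a positive limit, which makes the gap positive.\<close>

lemma gap_becomes_positive:
  obtains t1 where "t1 \<ge> 0" "\<And>t. t \<ge> t1 \<Longrightarrow> gap t > 0"
proof -
  have "\<exists>t1\<ge>0. gap t1 > 0"
  proof (rule ccontr)
    assume "\<not> (\<exists>t1\<ge>0. gap t1 > 0)"
    then have g: "gap t \<le> 0" if "t \<ge> 0" for t using that by force
    obtain c where c: "c > 0" "\<And>s. s > 0 \<Longrightarrow> \<alpha> 0 \<le> balance s \<Longrightarrow> c \<le> s"
      using balance_small[OF init(1)] by blast
    have "c \<le> s t" if "t \<ge> 0" for t
    proof -
      have "\<alpha> 0 \<le> \<alpha> t" using gap_nonpos_monotone(2)[of 0 t] that g always_positive by auto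
      then show ?thesis using g[OF that] c(2) s_pos[OF always_positive[OF that]] by (simp add: gap_def)
    qed
    moreover have "s u \<le> s t" if "0 \<le> t" "t \<le> u" for t u
      using gap_nonpos_monotone(1)[of t u] that g always_positive by auto
    ultimately obtain l where l: "((\<lambda>t. - s t) \<longlongrightarrow> l) at_top" "l \<le> - c"
      using mono_bounded_tendsto[of 0 "\<lambda>t. - s t" "- c"] by (metis neg_le_iff_le)
    have "(s \<longlongrightarrow> - l) at_top" using tendsto_minus[OF l(1)] by simp
    then obtain d where d: "d > 0" "eventually (\<lambda>t. gap t \<ge> d) at_top"
      using gap_eventually_bounded_below[of "- l"] l(2) c(1) by auto
    then have "eventually (\<lambda>t. gap t \<ge> d \<and> t \<ge> 0) at_top"
      by (intro eventually_conj eventually_ge_at_top)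
    then obtain t where "gap t \<ge> d" "t \<ge> 0"
      using eventually_happens trivial_limit_at_top_linorder by blast
    then show False using g[of t] d(1) by simp
  qed
  then obtain t1 where "t1 \<ge> 0" "gap t1 > 0" by blast
  then show thesis using that[of t1] gap_stays_positive always_positive by (meson order_trans)
qed

text \<open>Otherwise the increasing function \<open>s\<close> would converge; the gap and the speed would then be bounded below
  and \<open>s\<close> would grow without bound.\<close>

lemma s_at_top: "filterlim s at_top at_top"
proof (rule ccontr)
  assume not_top: "\<not> filterlim s at_top at_top"
  obtain t1 where t1: "t1 \<ge> 0" "\<And>t. t \<ge> t1 \<Longrightarrow> gap t > 0" using gap_becomes_positive by blast
  have mono: "s t \<le> s u" if "t1 \<le> t" "t \<le> u" for t u
    using gap_pos_monotone(1)[of t u] that t1 always_positive by auto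
  obtain M where M: "\<not> eventually (\<lambda>t. M \<le> s t) at_top"
    using not_top by (auto simp: filterlim_at_top)
  have "s t \<le> M" if "t \<ge> t1" for t
    using M mono[OF that] by (force simp: eventually_at_top_linorder)
  then obtain l where l: "(s \<longlongrightarrow> l) at_top" "\<And>t. t1 \<le> t \<Longrightarrow> s t \<le> l"
    using mono_bounded_tendsto[of t1 s M] mono by metis
  have l0: "l > 0" using l(2)[of t1] s_pos[OF always_positive[OF t1(1)]] by simp
  obtain d where d: "d > 0" "eventually (\<lambda>t. gap t \<ge> d) at_top"
    using gap_eventually_bounded_below[OF l(1) l0] by blast
  then obtain t2 where t2: "\<And>t. t \<ge> t2 \<Longrightarrow> gap t \<ge> d" by (auto simp: eventually_at_top_linorder)
  obtain k where k: "k > 0" "\<And>t. t \<ge> 0 \<Longrightarrow> k * deficit (s t) \<le> speed t" using speed_lower by blast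
  define c where "c = k * (1 / (2 * balance l + 1)) * d"
  have c: "c > 0" using k d balance_pos[OF l0] by (simp add: c_def)
  have "eventually (\<lambda>t. s t - l > 0) at_top"
  proof (rule eventually_pos_if_driven[where g = "\<lambda>t. c * t" and T = "max (max t1 1) t2"])
    show "filterlim (\<lambda>t. c * t) at_top at_top" using c(1) by real_asymp
    fix t assume t: "t \<ge> max (max t1 1) t2"
    have p: "positive t" using always_positive t by simp
    have sp: "s t > 0" by (rule s_pos[OF p])
    have "(s has_real_derivative speed t * gap t) (at t)"
      using derivative_s[of t] at_within_nonneg[of t] p t by simp
    moreover have "c \<le> speed t * gap t"
    proof -
      have "balance (s t) \<le> balance l"
        using balance_diff_ge[OF sp, of l] l(2)[of t] t by simp
      then have "1 / (2 * balance l + 1) \<le> 1 / (2 * balance (s t) + 1)"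
        using balance_pos[OF sp] by (intro divide_left_mono) auto
      also have "\<dots> = deficit (s t)"
        using deficit_balance[OF sp] balance_pos[OF sp] by (simp add: field_simps)
      finally have "k * (1 / (2 * balance l + 1)) \<le> speed t"
        using k(1) k(2)[of t] t by (meson dual_order.trans max.boundedE mult_left_mono less_imp_le zero_le_one)
      then show ?thesis unfolding c_def using t2[of t] t d(1) speed_pos[OF p]
        by (intro mult_mono) auto
    qed
    ultimately show "\<exists>f' g'. ((\<lambda>t. s t - l) has_real_derivative f') (at t) \<and>
        ((\<lambda>t. c * t) has_real_derivative g') (at t) \<and> (s t - l \<le> 0 \<longrightarrow> 0 < g' \<and> g' \<le> f')"
      using c(1) by (intro exI[of _ "speed t * gap t"] exI[of _ c])
        (auto intro!: derivative_eq_intros)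
  qed
  then have "eventually (\<lambda>t. s t - l > 0 \<and> t \<ge> t1) at_top"
    by (intro eventually_conj eventually_ge_at_top)
  then obtain t where "s t - l > 0" "t \<ge> t1"
    using eventually_happens trivial_limit_at_top_linorder by blast
  then show False using l(2)[of t] by simp
qed

text \<open>While \<open>gap \<ge> e\<close>, \<open>balance s\<close> moves with a speed of order at least \<open>1 / s\<close>, but \<open>\<alpha>\<close> only with speed
  \<open>O(1 / s\<^sup>2)\<close>. So \<open>gap = \<alpha> - balance s\<close> loses at least half of what \<open>balance s\<close> gains, and
  \<open>balance s / 2\<close> is the clock in \<open>eventually_pos_if_driven\<close>.\<close>

lemma gap_eventually_less:
  assumes e: "e > 0"
  shows "eventually (\<lambda>t. gap t < e) at_top"
proof -
  obtain t1 where t1: "t1 \<ge> 0" "\<And>t. t \<ge> t1 \<Longrightarrow> gap t > 0" using gap_becomes_positive by blast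
  obtain k where k: "k > 0" "\<And>t. t \<ge> 0 \<Longrightarrow> k * deficit (s t) \<le> speed t" using speed_lower by blast
  \<comment> \<open>half of the guaranteed drift of \<open>balance s\<close> is \<open>h * deficit s\<close>\<close>
  define h where "h = k * e / 2"
  have h: "h > 0" using k e by (simp add: h_def)
  have "eventually (\<lambda>x. 1 / (2 * x - 1) - 1 / (2 * x) + 3 / (4 * x\<^sup>2) \<le> h * (1 / (2 * x) - 3 / (4 * x\<^sup>2))) at_top"
    using h by real_asymp
  then have "eventually (\<lambda>t. 1 / (2 * s t - 1) - 1 / (2 * s t) + 3 / (4 * (s t)\<^sup>2) \<le> h * (1 / (2 * s t) - 3 / (4 * (s t)\<^sup>2))) at_top"
    by (rule eventually_compose_filterlim[OF _ s_at_top])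
  moreover have "eventually (\<lambda>t. s t > 1) at_top"
    using s_at_top by (simp add: filterlim_at_top_dense)
  ultimately have "eventually (\<lambda>t. s t > 1 \<and>
      1 / (2 * s t - 1) - 1 / (2 * s t) + 3 / (4 * (s t)\<^sup>2) \<le> h * (1 / (2 * s t) - 3 / (4 * (s t)\<^sup>2))) at_top"
    by eventually_elim simp
  then obtain T where T: "\<And>t. t \<ge> T \<Longrightarrow> s t > 1 \<and>
      1 / (2 * s t - 1) - 1 / (2 * s t) + 3 / (4 * (s t)\<^sup>2) \<le> h * (1 / (2 * s t) - 3 / (4 * (s t)\<^sup>2))"
    by (auto simp: eventually_at_top_linorder)
  have "eventually (\<lambda>t. e - gap t > 0) at_top"
  proof (rule eventually_pos_if_driven[where g = "\<lambda>t. balance (s t) / 2" and T = "max (max t1 1) T"])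
    have "filterlim (\<lambda>t. balance (s t)) at_top at_top"
    proof (rule filterlim_at_top_mono[OF s_at_top])
      show "eventually (\<lambda>t. s t \<le> balance (s t)) at_top"
        using eventually_ge_at_top[of 0] by eventually_elim (simp add: balance_ge s_pos always_positive)
    qed
    from filterlim_tendsto_pos_mult_at_top[OF tendsto_const _ this, of "1 / 2"]
    show "filterlim (\<lambda>t. balance (s t) / 2) at_top at_top" by simp
    fix t assume t: "t \<ge> max (max t1 1) T"
    then have t0: "t > 0" by simp
    have p: "positive t" using always_positive t0 by simp
    have s1: "s t > 1" and asym: "1 / (2 * s t - 1) - 1 / (2 * s t) + 3 / (4 * (s t)\<^sup>2) \<le> h * (1 / (2 * s t) - 3 / (4 * (s t)\<^sup>2))"
      using T[of t] t by auto
    have g: "gap t > 0" using t1(2) t by simp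
    obtain D where D: "D \<ge> 1"
      and Db: "((\<lambda>t. balance (s t)) has_real_derivative D * (speed t * gap t)) (at t)"
      and Dg: "(gap has_real_derivative digamma_gap (\<alpha> t) - log_mean (s t) - D * (speed t * gap t)) (at t)"
      using derivative_balance_s[of t] p t0 at_within_nonneg[OF t0] by auto
    have sg: "speed t * gap t > 0" using g speed_pos[OF p] by simp
    have Dsg: "speed t * gap t \<le> D * (speed t * gap t)"
      using mult_right_mono[OF D, of "speed t * gap t"] sg by simp
    have main: "digamma_gap (\<alpha> t) - log_mean (s t) \<le> D * (speed t * gap t) / 2" if "e \<le> gap t"
    proof -
      have "s t \<le> \<alpha> t" using balance_ge[of "s t"] s1 g by (simp add: gap_def)
      then have "digamma_gap (\<alpha> t) \<le> 1 / (2 * s t - 1)"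
        using digamma_gap_antimono[of "s t" "\<alpha> t"] digamma_gap_upper[of "s t"] s1 by simp
      then have "digamma_gap (\<alpha> t) - log_mean (s t) \<le> 1 / (2 * s t - 1) - 1 / (2 * s t) + 3 / (4 * (s t)\<^sup>2)"
        using log_mean_lower[of "s t"] s1 by simp
      also have "\<dots> \<le> h * (1 / (2 * s t) - 3 / (4 * (s t)\<^sup>2))" by (rule asym)
      also have "\<dots> \<le> h * deficit (s t)" using deficit_lower[of "s t"] s1 h by (intro mult_left_mono) auto
      also have "\<dots> = k * deficit (s t) * e / 2" by (simp add: h_def)
      also have "\<dots> \<le> speed t * gap t / 2"
        using k(2)[of t] t0 that e speed_pos[OF p] by (intro divide_right_mono mult_mono) auto
      also have "\<dots> \<le> D * (speed t * gap t) / 2" using Dsg by simp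
      finally show ?thesis .
    qed
    have "((\<lambda>t. e - gap t) has_real_derivative
        D * (speed t * gap t) - (digamma_gap (\<alpha> t) - log_mean (s t))) (at t)"
      using DERIV_diff[OF DERIV_const Dg, of e] by simp
    moreover have "((\<lambda>t. balance (s t) / 2) has_real_derivative D * (speed t * gap t) / 2) (at t)"
      using DERIV_cdivide[OF Db, of 2] .
    ultimately show "\<exists>f' g'. ((\<lambda>t. e - gap t) has_real_derivative f') (at t) \<and>
        ((\<lambda>t. balance (s t) / 2) has_real_derivative g') (at t) \<and> (e - gap t \<le> 0 \<longrightarrow> 0 < g' \<and> g' \<le> f')"
      using main sg Dsg
      by (intro exI[of _ "D * (speed t * gap t) - (digamma_gap (\<alpha> t) - log_mean (s t))"]
          exI[of _ "D * (speed t * gap t) / 2"]) auto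
  qed
  then show ?thesis by eventually_elim simp
qed

lemma gap_eventually_pos: "eventually (\<lambda>t. gap t > 0) at_top"
  using gap_becomes_positive by (metis eventually_at_top_linorder)

lemma gap_tendsto_0: "(gap \<longlongrightarrow> 0) at_top"
proof (rule order_tendstoI)
  fix y :: real assume "y < 0"
  then show "eventually (\<lambda>t. y < gap t) at_top"
    using gap_eventually_pos by (auto elim!: eventually_mono)
qed (rule gap_eventually_less)

lemma \<alpha>_over_s: "((\<lambda>t. \<alpha> t / s t) \<longlongrightarrow> 1) at_top"
proof -
  have "((\<lambda>t. balance (s t) / s t + gap t / s t) \<longlongrightarrow> 1 + 0) at_top"
    by (intro tendsto_add filterlim_compose[OF balance_asymp s_at_top]
        real_tendsto_divide_at_top[OF gap_tendsto_0 s_at_top])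
  then show ?thesis by (simp add: gap_def add_divide_distrib[symmetric])
qed

lemma V_est_eq: "V_est (\<alpha> t) (\<beta> t) (\<nu> t) = V * (s t / (\<alpha> t - 1))"
  using V by (simp add: V_est_def s_def \<sigma>_def mult.commute)

lemma eventually_s_gt: "eventually (\<lambda>t. s t > c) at_top"
  using s_at_top by (simp add: filterlim_at_top_dense)

text \<open>With \<open>balance y = \<alpha>\<close> we have \<open>y = \<alpha> - A(\<alpha>)\<close>, and \<open>0 < y - s \<le> gap\<close> since \<open>balance\<close> has slope at
  least 1. The gap is eventually below \<open>\<kappa> / 2\<close>, and \<open>\<kappa> / 2 < \<kappa> y / \<alpha>\<close> since \<open>\<alpha> < 2 s\<close> eventually.\<close>

lemma V_est_bounds:
  assumes "\<kappa> > 0"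
  shows "\<forall>\<^sub>F t in at_top.
            (1 - \<kappa> / \<alpha> t) * ((\<alpha> t - A (\<alpha> t)) / (\<alpha> t - 1)) < V_est (\<alpha> t) (\<beta> t) (\<nu> t) / V
          \<and> V_est (\<alpha> t) (\<beta> t) (\<nu> t) / V < (\<alpha> t - A (\<alpha> t)) / (\<alpha> t - 1)"
proof -
  have "eventually (\<lambda>t. \<alpha> t / s t < 2) at_top" using \<alpha>_over_s by (rule order_tendstoD) simp
  moreover have "eventually (\<lambda>t. gap t < \<kappa> / 2) at_top" using assms by (intro gap_eventually_less) simp
  ultimately show ?thesis
    using gap_eventually_pos eventually_s_gt[of 1] eventually_ge_at_top[of 0]
  proof eventually_elim
    case (elim t)
    have "balance (s t) < \<alpha> t" using elim by (simp add: gap_def)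
    then obtain y where y: "y > s t" "balance y = \<alpha> t"
      using balance_less_solution[of "s t" "\<alpha> t"] elim by auto
    have Ay: "\<alpha> t - A (\<alpha> t) = y" using A_balance[of y] y elim by simp
    have \<alpha>1: "\<alpha> t > 1" using balance_ge[of "s t"] elim by (simp add: gap_def)
    have V_est: "V_est (\<alpha> t) (\<beta> t) (\<nu> t) / V = s t / (\<alpha> t - 1)"
      using V_est_eq[of t] V by simp
    have "y - s t \<le> gap t" using balance_diff_ge[of "s t" y] y elim by (simp add: gap_def)
    also have "gap t < \<kappa> / 2" by (rule elim)
    also have "\<kappa> / 2 \<le> \<kappa> * y / \<alpha> t"
    proof -
      have "\<alpha> t < 2 * s t" using elim by (simp add: pos_divide_less_eq)
      then have "\<alpha> t \<le> 2 * y" using y by simp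
      then have "\<kappa> * \<alpha> t \<le> \<kappa> * (2 * y)" using assms by (intro mult_left_mono) auto
      then show ?thesis using \<alpha>1 by (simp add: field_simps)
    qed
    finally have "(1 - \<kappa> / \<alpha> t) * y < s t" by (simp add: algebra_simps)
    then have "(1 - \<kappa> / \<alpha> t) * y / (\<alpha> t - 1) < s t / (\<alpha> t - 1)"
      using \<alpha>1 by (intro divide_strict_right_mono) auto
    moreover have "s t / (\<alpha> t - 1) < y / (\<alpha> t - 1)"
      using \<alpha>1 y by (intro divide_strict_right_mono) auto
    ultimately show ?case unfolding Ay V_est by simp
  qed
qed

lemma V_est_tendsto: "((\<lambda>t. V_est (\<alpha> t) (\<beta> t) (\<nu> t)) \<longlongrightarrow> V) at_top"
proof -
  have "((\<lambda>t. V * (1 / (\<alpha> t / s t - 1 / s t))) \<longlongrightarrow> V * (1 / (1 - 0))) at_top"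
    by (intro tendsto_intros \<alpha>_over_s
        real_tendsto_divide_at_top[OF tendsto_const s_at_top]) simp
  moreover have "eventually (\<lambda>t. V * (1 / (\<alpha> t / s t - 1 / s t)) = V_est (\<alpha> t) (\<beta> t) (\<nu> t)) at_top"
    using eventually_s_gt[of 1] eventually_ge_at_top[of 0]
    by eventually_elim (simp add: V_est_eq diff_divide_distrib[symmetric])
  ultimately show ?thesis by (simp add: tendsto_cong)
qed

end

theorem corollary3p1:
  fixes V :: real and \<alpha> \<beta> \<nu> :: "real \<Rightarrow> real"
  assumes "V > 0"
    and "\<alpha> 0 > 0" and "\<beta> 0 > 0" and "\<nu> 0 > 0"
    and "\<And>t. t \<ge> 0 \<Longrightarrow>
      (\<alpha> has_real_derivative - E_dK_d\<alpha> V (\<alpha> t) (\<beta> t) (\<nu> t)) (at t within {0..})"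
    and "\<And>t. t \<ge> 0 \<Longrightarrow>
      (\<beta> has_real_derivative - E_dK_d\<beta> V (\<alpha> t) (\<beta> t) (\<nu> t)) (at t within {0..})"
    and "\<And>t. t \<ge> 0 \<Longrightarrow>
      (\<nu> has_real_derivative - E_dK_d\<nu> V (\<alpha> t) (\<beta> t) (\<nu> t)) (at t within {0..})"
  shows "(\<forall>\<kappa>>0. \<forall>\<^sub>F t in at_top.
            (1 - \<kappa> / \<alpha> t) * ((\<alpha> t - A (\<alpha> t)) / (\<alpha> t - 1))
              < V_est (\<alpha> t) (\<beta> t) (\<nu> t) / V
          \<and> V_est (\<alpha> t) (\<beta> t) (\<nu> t) / V < (\<alpha> t - A (\<alpha> t)) / (\<alpha> t - 1))
       \<and> ((\<lambda>t. V_est (\<alpha> t) (\<beta> t) (\<nu> t)) \<longlongrightarrow> V) at_top"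
proof -
  interpret gradient_flow V \<alpha> \<beta> \<nu> by unfold_locales (fact assms)+
  show ?thesis using V_est_bounds V_est_tendsto by blast
qed

end
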